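(* Let $\mathcal M$ and $\mathcal N$ be finite rank Beurling type invariant subspaces of $\bigotimes_{i=1}^kF^2(H_{n_i})\otimes\mathcal H$ which do not contain nontrivial reducing subspaces of $\mathbf S\otimes I_{\mathcal H}$. Then $\mathcal M$ and $\mathcal N$ are unitarily equivalent if and only if $$\mathrm{curv}((\mathbf S\otimes I_{\mathcal H})|_{\mathcal M})=\mathrm{curv}((\mathbf S\otimes I_{\mathcal H})|_{\mathcal N}).$$
   Context: All Hilbert spaces are complex; $\mathbb N=\{1,2,\ldots\}$. Fix $k\in\mathbb N$ and $\mathbf n=(n_1,\ldots,n_k)\in\mathbb N^k$, and let $\mathcal H$ be a Hilbert space. $F^2(H_{n_i})=\mathbb C1\oplus\bigoplus_{p\ge1}H_{n_i}^{\otimes p}$ is the full Fock space of an $n_i$-dimensional Hilbert space $H_{n_i}$ with orthonormal basis $e^i_1,\ldots,e^i_{n_i}$. $\mathbb F_{n_i}^+$ is the free unital semigroup on $n_i$ generators $g_1^i,\ldots,g_{n_i}^i$ with length $|\cdot|$; for $\alpha=g^i_{j_1}\cdots g^i_{j_p}$ put $e^i_\alpha=e^i_{j_1}\otimes\cdots\otimes e^i_{j_p}$, and $e^i_\alpha=1$ for the neutral element. Let $S_{i,j}e^i_\alpha=e^i_{g^i_j\alpha}$ be the left creation operators and $\mathbf S_{i,j}=I\otimes\cdots\otimes S_{i,j}\otimes\cdots\otimes I$ ($S_{i,j}$ in position $i$) on $\bigotimes_{i=1}^kF^2(H_{n_i})$; $\mathbf S=(\mathbf S_1,\ldots,\mathbf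 S_k)$, $\mathbf S_i=(\mathbf S_{i,1},\ldots,\mathbf S_{i,n_i})$. A subspace (closed) is invariant (resp. reducing) for $\mathbf S\otimes I_{\mathcal H}$ if it is so for every $\mathbf S_{i,j}\otimes I_{\mathcal H}$; nontrivial means nonzero. A bounded operator $\Psi:\bigotimes_iF^2(H_{n_i})\otimes\mathcal E\to\bigotimes_iF^2(H_{n_i})\otimes\mathcal H$ is multi-analytic if $\Psi(\mathbf S_{i,j}\otimes I_{\mathcal E})=(\mathbf S_{i,j}\otimes I_{\mathcal H})\Psi$ for all $i,j$, and inner if moreover it is a partial isometry. $\mathcal M$ is a Beurling type invariant subspace for $\mathbf S\otimes I_{\mathcal H}$ if $\mathcal M=\Psi[\bigotimes_iF^2(H_{n_i})\otimes\mathcal E]$ for some Hilbert space $\mathcal E$ and some inner multi-analytic operator $\Psi$; in this case $(\mathbf S\otimes I_{\mathcal H})|_{\mathcal M}$ (the tuple of restrictions) belongs to $\mathbf B_{\mathbf n}(\mathcal M)$ (defined below). $\mathcal M$ has finite rank if $(\mathbf S\otimes I_{\mathcal H})|_{\mathcal M}$ has finite rank. Two invariant subspaces $\mathcal M,\mathcal N$ are unitarily equivalent if there is a unitary $U:\mathcal M\to\mathcal N$ with $U(\mathbf S_{i,j}\otimes I_{\mathcal H})|_{\mathcal M}=(\mathbf S_{i,j}\otimes I_{\mathcal H})|_{\mathcal N}U$ for all $i,j$. For a Hilbert space $\mathcal G$ and $X_i=(X_{i,1},\ldots,X_{i,n_i})\in B(\mathcal G)^{n_i}$ let $\Phi_{X_i}(Y)=\sum_{j=1}^{n_i}X_{i,j}YX_{i,j}^*$.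 The regular polyball $\mathbf B_{\mathbf n}(\mathcal G)$ is the set of all $\mathbf X=(X_1,\ldots,X_k)$ with $X_i\in B(\mathcal G)^{n_i}$ such that every entry of $X_s$ commutes with every entry of $X_t$ whenever $s\ne t$ and $(id-\Phi_{X_1})^{p_1}\circ\cdots\circ(id-\Phi_{X_k})^{p_k}(I)\ge0$ for all $(p_1,\ldots,p_k)\in\{0,1\}^k$. Put $\mathbf\Delta_{\mathbf X}=(id-\Phi_{X_1})\circ\cdots\circ(id-\Phi_{X_k})$. $\mathbf T\in\mathbf B_{\mathbf n}(\mathcal G)$ has finite rank if $\mathbf\Delta_{\mathbf T}(I)$ has finite rank. With $\mathcal D_{\mathbf T}=\overline{\mathbf\Delta_{\mathbf T}(I)\mathcal G}$ and $T_{i,\alpha}=T_{i,j_1}\cdots T_{i,j_p}$ for $\alpha=g^i_{j_1}\cdots g^i_{j_p}$ ($T_{i,\alpha}=I$ for the neutral element), the Berezin kernel $\mathbf K_{\mathbf T}:\mathcal G\to\bigotimes_iF^2(H_{n_i})\otimes\mathcal D_{\mathbf T}$ is $$\mathbf K_{\mathbf T}h=\sum_{\beta_i\in\mathbb F_{n_i}^+,\,i=1,\ldots,k}e^1_{\beta_1}\otimes\cdots\otimes e^k_{\beta_k}\otimes\mathbf\Delta_{\mathbf T}(I)^{1/2}T_{1,\beta_1}^*\cdots T_{k,\beta_k}^*h.$$ $P^{(i)}_q$ is the orthogonal projection of $F^2(H_{n_i})$ onto the span of all $e^i_\alpha$ with $|\alpha|=q$. For $\mathbf T$ with trace class $\mathbf\Delta_{\mathbf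 T}(I)$, $$\mathrm{curv}(\mathbf T):=\lim_{m\to\infty}\frac1{\binom{m+k}{k}}\sum_{\substack{q_1\ge0,\ldots,q_k\ge0\\ q_1+\cdots+q_k\le m}}\frac{\mathrm{trace}\left[\mathbf K_{\mathbf T}^*(P^{(1)}_{q_1}\otimes\cdots\otimes P^{(k)}_{q_k}\otimes I_{\mathcal D_{\mathbf T}})\mathbf K_{\mathbf T}\right]}{\mathrm{trace}\left[P^{(1)}_{q_1}\otimes\cdots\otimes P^{(k)}_{q_k}\right]}$$ (this limit exists). *)

theory Defs
  imports "HOL-Analysis.Analysis"
begin

section \<open>Complex Hilbert spaces\<close>

text \<open>
  A complex Hilbert space carries the real inner product \<open>Re \<langle>x, y\<rangle>\<close>, so the norm, metric and
  topology are the ones of the class \<^class>\<open>real_inner\<close>. Inner products are linear in the first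
  argument.
\<close>

class complex_vector = real_vector +
  fixes scaleC :: "complex \<Rightarrow> 'a \<Rightarrow> 'a" (infixr "*\<^sub>C" 75)
  assumes scaleC_add_right: "a *\<^sub>C (x + y) = a *\<^sub>C x + a *\<^sub>C y"
    and scaleC_add_left: "(a + b) *\<^sub>C x = a *\<^sub>C x + b *\<^sub>C x"
    and scaleC_scaleC: "a *\<^sub>C (b *\<^sub>C x) = (a * b) *\<^sub>C x"
    and scaleR_scaleC: "r *\<^sub>R x = complex_of_real r *\<^sub>C x"

class complex_inner = complex_vector + real_inner +
  fixes cinner :: "'a \<Rightarrow> 'a \<Rightarrow> complex"
  assumes cinner_commute: "cinner x y = cnj (cinner y x)"
    and cinner_add_left: "cinner (x + y) z = cinner x z + cinner y z"
    and cinner_scaleC_left: "cinner (c *\<^sub>C x) y = c * cinner x y"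
    and inner_eq_Re_cinner: "inner x y = Re (cinner x y)"

class chilbert_space = complex_inner + complete_space

lemma scaleC_one: "1 *\<^sub>C x = (x :: 'a::complex_vector)"
  using scaleR_scaleC[of 1 x] by simp

global_interpretation complex_vector: vector_space "scaleC :: complex \<Rightarrow> 'a \<Rightarrow> 'a::complex_vector"
  defines csubspace = complex_vector.subspace and cspan = complex_vector.span
  by unfold_locales (simp_all add: scaleC_add_right scaleC_add_left scaleC_scaleC scaleC_one)

lemma Im_cinner: "Im (cinner x y) = inner x (\<i> *\<^sub>C y)" for x y :: "'a::complex_inner"
proof -
  have "cinner x (\<i> *\<^sub>C y) = cnj (\<i> * cinner y x)"
    using cinner_commute[of x "\<i> *\<^sub>C y"] by (simp add: cinner_scaleC_left)
  also have "\<dots> = - \<i> * cinner x y"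
    using cinner_commute[of x y] by simp
  finally show ?thesis by (simp add: inner_eq_Re_cinner)
qed

lemma cinner_self: "cinner x x = complex_of_real ((norm x)\<^sup>2)" for x :: "'a::complex_inner"
proof (rule complex_eqI)
  show "Re (cinner x x) = Re (complex_of_real ((norm x)\<^sup>2))"
    by (simp add: power2_norm_eq_inner inner_eq_Re_cinner)
  show "Im (cinner x x) = Im (complex_of_real ((norm x)\<^sup>2))"
    using arg_cong[OF cinner_commute[of x x], of Im] by simp
qed

lemma norm_scaleC: "norm (c *\<^sub>C x) = cmod c * norm x" for x :: "'a::complex_inner"
proof -
  have "cinner (c *\<^sub>C x) (c *\<^sub>C x) = c * cnj (c * cinner x x)"
    by (subst cinner_scaleC_left, subst cinner_commute) (simp add: cinner_scaleC_left)
  also have "\<dots> = (c * cnj c) * cinner x x"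
    by (simp add: cinner_self)
  also have "\<dots> = complex_of_real ((cmod c * norm x)\<^sup>2)"
    using complex_norm_square[of c] by (simp add: cinner_self power_mult_distrib)
  finally have "(norm (c *\<^sub>C x))\<^sup>2 = (cmod c * norm x)\<^sup>2"
    unfolding cinner_self of_real_eq_iff .
  then show ?thesis by (simp add: power2_eq_iff_nonneg)
qed

lemma cmod_cinner_le: "cmod (cinner x y) \<le> 2 * norm x * norm y" for x y :: "'a::complex_inner"
proof -
  have "\<bar>Re (cinner x y)\<bar> \<le> norm x * norm y"
    using Cauchy_Schwarz_ineq2[of x y] by (simp add: inner_eq_Re_cinner)
  moreover have "\<bar>Im (cinner x y)\<bar> \<le> norm x * norm y"
    using Cauchy_Schwarz_ineq2[of x "\<i> *\<^sub>C y"] by (simp add: Im_cinner norm_scaleC)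
  ultimately show ?thesis using cmod_le[of "cinner x y"] by linarith
qed

instantiation complex :: chilbert_space
begin
definition "scaleC_complex (a::complex) (x::complex) = a * x"
definition "cinner_complex (x::complex) (y::complex) = x * cnj y"
instance
  by standard
     (simp_all add: scaleC_complex_def cinner_complex_def algebra_simps inner_complex_def scaleR_conv_of_real)
end


section \<open>Square-summable families\<close>

text \<open>
  \<open>('x, 'a) l2\<close> is the Hilbert space of square-summable families of vectors of \<open>'a\<close> indexed by \<open>'x\<close>,
  i.e. the Hilbert space tensor product of \<open>\<ell>\<^sup>2('x)\<close> with \<open>'a\<close>.
\<close>

typedef (overloaded) ('x, 'a::complex_inner) l2 =
  "{f :: 'x \<Rightarrow> 'a. (\<lambda>x. (norm (f x))\<^sup>2) summable_on UNIV}"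
  morphisms coord Abs_l2
  by (rule exI[of _ "\<lambda>_. 0"]) simp

setup_lifting type_definition_l2

lemma l2_summable: "(\<lambda>x. (norm (coord f x))\<^sup>2) summable_on UNIV"
  using coord[of f] by simp

lemma l2_eqI: "(\<And>x. coord f x = coord g x) \<Longrightarrow> f = g"
  by (simp add: coord_inject[symmetric] fun_eq_iff)

lemma l2_summable_comparison:
  fixes h :: "'x \<Rightarrow> 'c::banach"
  assumes "\<And>x. norm (h x) \<le> c * ((norm (coord f x))\<^sup>2 + (norm (coord g x))\<^sup>2)"
  shows "h summable_on UNIV"
proof -
  have "(\<lambda>x. c * ((norm (coord f x))\<^sup>2 + (norm (coord g x))\<^sup>2)) summable_on UNIV"
    by (intro summable_on_cmult_right summable_on_add l2_summable)
  then have "(\<lambda>x. norm (h x)) summable_on UNIV"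
    by (rule summable_on_comparison_test) (auto intro: assms)
  then show ?thesis by (rule abs_summable_summable)
qed

lemma two_mult_le: "2 * (a * b) \<le> a\<^sup>2 + b\<^sup>2" for a b :: real
  using sum_squares_bound[of a b] by (simp add: mult.assoc)

lemma norm_add_sq_le: "(norm (x + y))\<^sup>2 \<le> 2 * ((norm x)\<^sup>2 + (norm y)\<^sup>2)"
  for x y :: "'a::real_normed_vector"
proof -
  have "(norm (x + y))\<^sup>2 \<le> (norm x + norm y)\<^sup>2"
    by (intro power_mono norm_triangle_ineq) simp
  also have "\<dots> \<le> 2 * ((norm x)\<^sup>2 + (norm y)\<^sup>2)"
    using two_mult_le[of "norm x" "norm y"] by (simp add: power2_sum)
  finally show ?thesis .
qed

lemma l2_cinner_summable: "(\<lambda>x. cinner (coord f x) (coord g x)) summable_on UNIV"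
proof (rule l2_summable_comparison[of _ 1 f g])
  fix x
  show "cmod (cinner (coord f x) (coord g x)) \<le> 1 * ((norm (coord f x))\<^sup>2 + (norm (coord g x))\<^sup>2)"
    using cmod_cinner_le[of "coord f x" "coord g x"] two_mult_le[of "norm (coord f x)" "norm (coord g x)"]
    by simp
qed

lemma l2_inner_summable: "(\<lambda>x. inner (coord f x) (coord g x)) summable_on UNIV"
  using summable_on_Re[OF l2_cinner_summable[of f g]] by (simp add: inner_eq_Re_cinner)

instantiation l2 :: (type, complex_inner) complex_inner
begin

lift_definition zero_l2 :: "('a, 'b) l2" is "\<lambda>_. 0" by simp

lift_definition plus_l2 :: "('a, 'b) l2 \<Rightarrow> ('a, 'b) l2 \<Rightarrow> ('a, 'b) l2" is "\<lambda>f g x. f x + g x"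
proof -
  fix f g :: "'a \<Rightarrow> 'b"
  assume "(\<lambda>x. (norm (f x))\<^sup>2) summable_on UNIV" "(\<lambda>x. (norm (g x))\<^sup>2) summable_on UNIV"
  then have "(\<lambda>x. 2 * ((norm (f x))\<^sup>2 + (norm (g x))\<^sup>2)) summable_on UNIV"
    by (intro summable_on_cmult_right summable_on_add)
  then show "(\<lambda>x. (norm (f x + g x))\<^sup>2) summable_on UNIV"
    by (rule summable_on_comparison_test) (simp_all only: norm_add_sq_le zero_le_power2)
qed

lift_definition uminus_l2 :: "('a, 'b) l2 \<Rightarrow> ('a, 'b) l2" is "\<lambda>f x. - f x" by simp

definition minus_l2 :: "('a, 'b) l2 \<Rightarrow> ('a, 'b) l2 \<Rightarrow> ('a, 'b) l2" where
  "minus_l2 f g = f + - g"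

lift_definition scaleC_l2 :: "complex \<Rightarrow> ('a, 'b) l2 \<Rightarrow> ('a, 'b) l2" is "\<lambda>c f x. c *\<^sub>C f x"
  by (simp add: norm_scaleC power_mult_distrib summable_on_cmult_right)

definition scaleR_l2 :: "real \<Rightarrow> ('a, 'b) l2 \<Rightarrow> ('a, 'b) l2" where
  "scaleR_l2 r f = complex_of_real r *\<^sub>C f"

definition cinner_l2 :: "('a, 'b) l2 \<Rightarrow> ('a, 'b) l2 \<Rightarrow> complex" where
  "cinner_l2 f g = (\<Sum>\<^sub>\<infinity>x. cinner (coord f x) (coord g x))"

definition inner_l2 :: "('a, 'b) l2 \<Rightarrow> ('a, 'b) l2 \<Rightarrow> real" where
  "inner_l2 f g = Re (cinner f g)"

definition norm_l2 :: "('a, 'b) l2 \<Rightarrow> real" where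
  "norm_l2 f = sqrt (inner f f)"

definition sgn_l2 :: "('a, 'b) l2 \<Rightarrow> ('a, 'b) l2" where
  "sgn_l2 f = inverse (norm f) *\<^sub>R f"

definition dist_l2 :: "('a, 'b) l2 \<Rightarrow> ('a, 'b) l2 \<Rightarrow> real" where
  "dist_l2 f g = norm (f - g)"

definition uniformity_l2 :: "(('a, 'b) l2 \<times> ('a, 'b) l2) filter" where
  "uniformity_l2 = (INF e\<in>{0<..}. principal {(x, y). dist x y < e})"

definition open_l2 :: "('a, 'b) l2 set \<Rightarrow> bool" where
  "open_l2 U = (\<forall>x\<in>U. eventually (\<lambda>(x', y). x' = x \<longrightarrow> y \<in> U) uniformity)"

lemma coord_scaleR_l2: "coord (r *\<^sub>R f) x = r *\<^sub>R coord f x" for f :: "('a, 'b) l2"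
  by (simp add: scaleR_l2_def scaleC_l2.rep_eq scaleR_scaleC)

lemma inner_l2_eq: "inner f g = (\<Sum>\<^sub>\<infinity>x. inner (coord f x) (coord g x))" for f g :: "('a, 'b) l2"
  by (simp add: inner_l2_def cinner_l2_def inner_eq_Re_cinner infsum_Re[OF l2_cinner_summable])

instance
proof
  fix f g h :: "('a, 'b) l2" and a b c :: complex and r s :: real
  show "f + g + h = f + (g + h)"
    by (rule l2_eqI) (simp add: plus_l2.rep_eq add.assoc)
  show "f + g = g + f"
    by (rule l2_eqI) (simp add: plus_l2.rep_eq add.commute)
  show "0 + f = f"
    by (rule l2_eqI) (simp add: plus_l2.rep_eq zero_l2.rep_eq)
  show "- f + f = 0"
    by (rule l2_eqI) (simp add: plus_l2.rep_eq zero_l2.rep_eq uminus_l2.rep_eq)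
  show "f - g = f + - g"
    by (rule minus_l2_def)
  show "r *\<^sub>R (f + g) = r *\<^sub>R f + r *\<^sub>R g"
    by (rule l2_eqI) (simp add: plus_l2.rep_eq coord_scaleR_l2 scaleR_add_right)
  show "(r + s) *\<^sub>R f = r *\<^sub>R f + s *\<^sub>R f"
    by (rule l2_eqI) (simp add: plus_l2.rep_eq coord_scaleR_l2 scaleR_add_left)
  show "r *\<^sub>R s *\<^sub>R f = (r * s) *\<^sub>R f"
    by (rule l2_eqI) (simp add: coord_scaleR_l2)
  show "1 *\<^sub>R f = f"
    by (rule l2_eqI) (simp add: coord_scaleR_l2)
  show "a *\<^sub>C (f + g) = a *\<^sub>C f + a *\<^sub>C g"
    by (rule l2_eqI) (simp add: plus_l2.rep_eq scaleC_l2.rep_eq scaleC_add_right)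
  show "(a + b) *\<^sub>C f = a *\<^sub>C f + b *\<^sub>C f"
    by (rule l2_eqI) (simp add: plus_l2.rep_eq scaleC_l2.rep_eq scaleC_add_left)
  show "a *\<^sub>C b *\<^sub>C f = (a * b) *\<^sub>C f"
    by (rule l2_eqI) (simp add: scaleC_l2.rep_eq scaleC_scaleC)
  show "r *\<^sub>R f = complex_of_real r *\<^sub>C f"
    by (rule scaleR_l2_def)
  show "cinner f g = cnj (cinner g f)"
    unfolding cinner_l2_def infsum_cnj[symmetric]
    by (rule infsum_cong) (rule cinner_commute)
  show "cinner (f + g) h = cinner f h + cinner g h"
    by (simp add: cinner_l2_def plus_l2.rep_eq cinner_add_left infsum_add l2_cinner_summable)
  show "cinner (c *\<^sub>C f) g = c * cinner f g"
    by (simp add: cinner_l2_def scaleC_l2.rep_eq cinner_scaleC_left infsum_cmult_right')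
  show "inner f g = Re (cinner f g)"
    by (rule inner_l2_def)
  show "dist f g = norm (f - g)" by (rule dist_l2_def)
  show "sgn f = inverse (norm f) *\<^sub>R f" by (rule sgn_l2_def)
  show "norm f = sqrt (inner f f)" by (rule norm_l2_def)
  show "inner f g = inner g f"
    by (simp add: inner_l2_eq inner_commute)
  show "inner (f + g) h = inner f h + inner g h"
    by (simp add: inner_l2_eq plus_l2.rep_eq inner_add_left infsum_add l2_inner_summable)
  show "inner (r *\<^sub>R f) g = r * inner f g"
    by (simp add: inner_l2_eq coord_scaleR_l2 infsum_cmult_right')
  show "0 \<le> inner f f"
    by (simp add: inner_l2_eq infsum_nonneg)
  show "inner f f = 0 \<longleftrightarrow> f = 0"
  proof
    assume "inner f f = 0"
    then have "inner (coord f x) (coord f x) = 0" for x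
      using nonneg_infsum_le_0D[of "\<lambda>x. inner (coord f x) (coord f x)" UNIV x]
      by (simp add: inner_l2_eq l2_inner_summable)
    then show "f = 0"
      by (intro l2_eqI) (simp add: zero_l2.rep_eq)
  next
    assume "f = 0"
    then show "inner f f = 0" by (simp add: inner_l2_eq zero_l2.rep_eq)
  qed
qed (rule uniformity_l2_def open_l2_def)+

end

lemma coord_diff: "coord (f - g) x = coord f x - coord g x"
  unfolding minus_l2_def plus_l2.rep_eq uminus_l2.rep_eq by simp

lemma coord_sum: "coord (\<Sum>i\<in>I. f i) x = (\<Sum>i\<in>I. coord (f i) x)"
  by (induction I rule: infinite_finite_induct) (simp_all add: zero_l2.rep_eq plus_l2.rep_eq)

lemma norm_l2_sq: "(norm f)\<^sup>2 = (\<Sum>\<^sub>\<infinity>x. (norm (coord f x))\<^sup>2)"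
  unfolding power2_norm_eq_inner inner_l2_eq ..

lemma sum_norm_coord_le: "finite A \<Longrightarrow> (\<Sum>x\<in>A. (norm (coord f x))\<^sup>2) \<le> (norm f)\<^sup>2"
  unfolding norm_l2_sq by (rule finite_sum_le_infsum) (auto intro: l2_summable)

lemma norm_coord_le: "norm (coord f x) \<le> norm f"
  using sum_norm_coord_le[of "{x}" f] by (intro power2_le_imp_le[OF _ norm_ge_zero]) simp

instance l2 :: (type, chilbert_space) chilbert_space
proof
  fix X :: "nat \<Rightarrow> ('a, 'b) l2"
  assume X: "Cauchy X"
  have "Cauchy (\<lambda>n. coord (X n) x)" for x
  proof (rule metric_CauchyI)
    fix e :: real assume "0 < e"
    then obtain N where "\<And>m n. m \<ge> N \<Longrightarrow> n \<ge> N \<Longrightarrow> dist (X m) (X n) < e"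
      using metric_CauchyD[OF X] by blast
    moreover have "dist (coord (X m) x) (coord (X n) x) \<le> dist (X m) (X n)" for m n
      using norm_coord_le[of "X m - X n" x] by (simp add: dist_norm coord_diff)
    ultimately show "\<exists>M. \<forall>m\<ge>M. \<forall>n\<ge>M. dist (coord (X m) x) (coord (X n) x) < e"
      by (intro exI[of _ N]) (blast intro: order_le_less_trans)
  qed
  then have "\<exists>l. (\<lambda>n. coord (X n) x) \<longlonglongrightarrow> l" for x
    by (simp add: Cauchy_convergent_iff convergent_def)
  then obtain l where l: "\<And>x. (\<lambda>n. coord (X n) x) \<longlonglongrightarrow> l x" by metis
  have bound: "(\<Sum>x\<in>A. (norm (coord (X m) x - l x))\<^sup>2) \<le> e\<^sup>2"
    if "finite A" "m \<ge> N" and N: "\<And>m n. m \<ge> N \<Longrightarrow> n \<ge> N \<Longrightarrow> dist (X m) (X n) < e" for A m N e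
  proof (rule LIMSEQ_le_const2)
    show "(\<lambda>n. \<Sum>x\<in>A. (norm (coord (X m) x - coord (X n) x))\<^sup>2)
        \<longlonglongrightarrow> (\<Sum>x\<in>A. (norm (coord (X m) x - l x))\<^sup>2)"
      by (intro tendsto_intros l)
    show "\<exists>N. \<forall>n\<ge>N. (\<Sum>x\<in>A. (norm (coord (X m) x - coord (X n) x))\<^sup>2) \<le> e\<^sup>2"
    proof (intro exI[of _ N] allI impI)
      fix n assume "n \<ge> N"
      then have "norm (X m - X n) \<le> e"
        using N[OF \<open>m \<ge> N\<close>] by (simp add: dist_norm less_imp_le)
      then have "(norm (X m - X n))\<^sup>2 \<le> e\<^sup>2" by (intro power_mono) auto
      then show "(\<Sum>x\<in>A. (norm (coord (X m) x - coord (X n) x))\<^sup>2) \<le> e\<^sup>2"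
        using sum_norm_coord_le[OF \<open>finite A\<close>, of "X m - X n"] by (simp add: coord_diff)
    qed
  qed
  have summ: "(\<lambda>x. (norm (coord (X m) x - l x))\<^sup>2) summable_on UNIV"
    if "m \<ge> N" "\<And>m n. m \<ge> N \<Longrightarrow> n \<ge> N \<Longrightarrow> dist (X m) (X n) < e" for m N e
    using bound[OF _ that]
    by (intro nonneg_bdd_above_summable_on bdd_aboveI[of _ "e\<^sup>2"]) auto
  obtain N1 where N1: "\<And>m n. m \<ge> N1 \<Longrightarrow> n \<ge> N1 \<Longrightarrow> dist (X m) (X n) < 1"
    using metric_CauchyD[OF X zero_less_one] by blast
  define d where "d = Abs_l2 (\<lambda>x. coord (X N1) x - l x)"
  have d: "coord d x = coord (X N1) x - l x" for x
    unfolding d_def using summ[OF order_refl N1] by (subst Abs_l2_inverse) auto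
  define f where "f = X N1 - d"
  have f: "coord f x = l x" for x
    by (simp add: f_def coord_diff d)
  have "X \<longlonglongrightarrow> f"
  proof (rule metric_LIMSEQ_I)
    fix r :: real assume "0 < r"
    then obtain N where N: "\<And>m n. m \<ge> N \<Longrightarrow> n \<ge> N \<Longrightarrow> dist (X m) (X n) < r / 2"
      using metric_CauchyD[OF X half_gt_zero[OF \<open>0 < r\<close>]] by blast
    have "dist (X n) f < r" if "n \<ge> N" for n
    proof -
      have "(norm (X n - f))\<^sup>2 \<le> (r / 2)\<^sup>2"
        unfolding norm_l2_sq coord_diff f
        by (rule infsum_le_finite_sums[OF summ[OF that N]]) (use bound[OF _ that N] in auto)
      then have "norm (X n - f) \<le> r / 2"
        by (rule power2_le_imp_le) (use \<open>0 < r\<close> in simp)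
      then show ?thesis using \<open>0 < r\<close> by (simp add: dist_norm)
    qed
    then show "\<exists>no. \<forall>n\<ge>no. dist (X n) f < r" by blast
  qed
  then show "convergent X" by (auto simp: convergent_def)
qed


section \<open>Operators on closed subspaces\<close>

text \<open>
  A Hilbert space \<open>G\<close> is given as a closed subspace of some type of class \<^class>\<open>chilbert_space\<close>
  (possibly the whole type); this makes restrictions to invariant subspaces available. An operator
  on \<open>G\<close> is a function on the ambient type of which only the values on \<open>G\<close> matter.
\<close>

definition closed_csubspace :: "'a::chilbert_space set \<Rightarrow> bool" where
  "closed_csubspace G \<longleftrightarrow> csubspace G \<and> closed G"

definition bounded_op :: "'a::chilbert_space set \<Rightarrow> 'b::chilbert_space set \<Rightarrow> ('a \<Rightarrow> 'b) \<Rightarrow> bool" where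
  "bounded_op G H A \<longleftrightarrow>
     A ` G \<subseteq> H \<and>
     (\<forall>x\<in>G. \<forall>y\<in>G. A (x + y) = A x + A y) \<and>
     (\<forall>c. \<forall>x\<in>G. A (c *\<^sub>C x) = c *\<^sub>C A x) \<and>
     (\<exists>B. \<forall>x\<in>G. norm (A x) \<le> B * norm x)"

definition adj :: "'a::chilbert_space set \<Rightarrow> ('a \<Rightarrow> 'b::chilbert_space) \<Rightarrow> 'b \<Rightarrow> 'a" where
  "adj G A y = (THE x. x \<in> G \<and> (\<forall>z\<in>G. cinner (A z) y = cinner z x))"

definition partial_isometry :: "'a::chilbert_space set \<Rightarrow> ('a \<Rightarrow> 'b::chilbert_space) \<Rightarrow> bool" where
  "partial_isometry G A \<longleftrightarrow>
     (\<forall>x\<in>G. (\<forall>z\<in>G. A z = 0 \<longrightarrow> cinner x z = 0) \<longrightarrow> norm (A x) = norm x)"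

definition unitary_op :: "'a::chilbert_space set \<Rightarrow> 'b::chilbert_space set \<Rightarrow> ('a \<Rightarrow> 'b) \<Rightarrow> bool" where
  "unitary_op G H U \<longleftrightarrow>
     bounded_op G H U \<and> U ` G = H \<and> (\<forall>x\<in>G. \<forall>y\<in>G. cinner (U x) (U y) = cinner x y)"

definition positive_op :: "'a::chilbert_space set \<Rightarrow> ('a \<Rightarrow> 'a) \<Rightarrow> bool" where
  "positive_op G A \<longleftrightarrow>
     bounded_op G G A \<and> (\<forall>x\<in>G. cinner (A x) x \<in> \<real> \<and> 0 \<le> Re (cinner (A x) x))"

text \<open>The positive square root of a positive operator is determined only on \<open>G\<close>, hence the use of
  \<open>SOME\<close> instead of \<open>THE\<close>.\<close>

definition sqrt_op :: "'a::chilbert_space set \<Rightarrow> ('a \<Rightarrow> 'a) \<Rightarrow> 'a \<Rightarrow> 'a" where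
  "sqrt_op G A = (SOME B. positive_op G B \<and> (\<forall>x\<in>G. B (B x) = A x))"

definition orthonormal_basis :: "'a::chilbert_space set \<Rightarrow> 'a set \<Rightarrow> bool" where
  "orthonormal_basis G B \<longleftrightarrow>
     B \<subseteq> G \<and> (\<forall>x\<in>B. \<forall>y\<in>B. cinner x y = (if x = y then 1 else 0)) \<and> closure (cspan B) = G"

definition op_trace :: "'a::chilbert_space set \<Rightarrow> ('a \<Rightarrow> 'a) \<Rightarrow> complex" where
  "op_trace G A = (\<Sum>\<^sub>\<infinity>e\<in>(SOME B. orthonormal_basis G B). cinner (A e) e)"

definition finite_rank_op :: "'a::chilbert_space set \<Rightarrow> ('a \<Rightarrow> 'b::chilbert_space) \<Rightarrow> bool" where
  "finite_rank_op G A \<longleftrightarrow> (\<exists>B. finite B \<and> A ` G \<subseteq> cspan B)"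


section \<open>Tensor products of full Fock spaces\<close>

text \<open>
  A word \<open>g\<^sup>i\<^bsub>j\<^sub>1\<^esub> \<cdots> g\<^sup>i\<^bsub>j\<^sub>p\<^esub>\<close> is the list \<open>[j\<^sub>1, \<dots>, j\<^sub>p]\<close> over \<open>{1..n i}\<close>, and a tuple
  \<open>(\<beta>\<^sub>1, \<dots>, \<beta>\<^sub>k)\<close> of words is an extensional function on \<open>{1..k}\<close>. These tuples index the orthonormal basis
  \<open>e\<^sup>1\<^bsub>\<beta>\<^sub>1\<^esub> \<otimes> \<cdots> \<otimes> e\<^sup>k\<^bsub>\<beta>\<^sub>k\<^esub>\<close> of \<open>F\<^sup>2(H\<^bsub>n\<^sub>1\<^esub>) \<otimes> \<cdots> \<otimes> F\<^sup>2(H\<^bsub>n\<^sub>k\<^esub>)\<close>, so the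
  tensor product of the latter with \<open>E\<close> consists of the square-summable families of vectors of \<open>E\<close>
  supported on them. The case \<open>E = \<complex>\<close> is the tensor product of the Fock spaces alone.
\<close>

type_synonym multiword = "nat \<Rightarrow> nat list"

definition multiwords :: "nat \<Rightarrow> (nat \<Rightarrow> nat) \<Rightarrow> multiword set" where
  "multiwords k n = (\<Pi>\<^sub>E i\<in>{1..k}. lists {1..n i})"

definition fock :: "nat \<Rightarrow> (nat \<Rightarrow> nat) \<Rightarrow> 'a::chilbert_space set \<Rightarrow> (multiword, 'a) l2 set" where
  "fock k n E = {f. (\<forall>\<beta>\<in>multiwords k n. coord f \<beta> \<in> E) \<and> (\<forall>\<beta>. \<beta> \<notin> multiwords k n \<longrightarrow> coord f \<beta> = 0)}"

text \<open>The elementary tensor \<open>e\<^sup>1\<^bsub>\<beta>\<^sub>1\<^esub> \<otimes> \<cdots> \<otimes> e\<^sup>k\<^bsub>\<beta>\<^sub>k\<^esub> \<otimes> h\<close>.\<close>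

lift_definition basis_tensor :: "'x \<Rightarrow> 'a::complex_inner \<Rightarrow> ('x, 'a) l2"
  is "\<lambda>\<beta> h \<gamma>. if \<gamma> = \<beta> then h else 0"
proof -
  fix \<beta> :: 'x and h :: 'a
  show "(\<lambda>\<gamma>. (norm (if \<gamma> = \<beta> then h else 0))\<^sup>2) summable_on UNIV"
    by (rule finite_nonzero_values_imp_summable_on, rule finite_subset[of _ "{\<beta>}"])
       (auto split: if_splits)
qed

text \<open>
  The operator \<open>\<^bold>S\<^bsub>i,j\<^esub> \<otimes> I\<close>; see \<open>creation_basis_tensor\<close> below for its action on elementary tensors. It
  is polymorphic in the coefficient space.
\<close>

lift_definition creation :: "nat \<Rightarrow> nat \<Rightarrow> (multiword, 'a::complex_inner) l2 \<Rightarrow> (multiword, 'a) l2"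
  is "\<lambda>i j f \<gamma>. if \<gamma> i \<noteq> [] \<and> hd (\<gamma> i) = j then f (\<gamma>(i := tl (\<gamma> i))) else 0"
proof -
  fix i j and f :: "multiword \<Rightarrow> 'a"
  assume f: "(\<lambda>\<gamma>. (norm (f \<gamma>))\<^sup>2) summable_on UNIV"
  define \<phi> where "\<phi> = (\<lambda>\<beta> :: multiword. \<beta>(i := j # \<beta> i))"
  define F where "F = (\<lambda>\<gamma>. if \<gamma> i \<noteq> [] \<and> hd (\<gamma> i) = j then f (\<gamma>(i := tl (\<gamma> i))) else 0)"
  have inj: "inj \<phi>"
    by (rule inj_on_inverseI[of _ "\<lambda>\<gamma>. \<gamma>(i := tl (\<gamma> i))"]) (simp add: \<phi>_def)
  have "F (\<phi> \<beta>) = f \<beta>" for \<beta>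
    by (simp add: F_def \<phi>_def)
  then have "((\<lambda>\<gamma>. (norm (F \<gamma>))\<^sup>2) \<circ> \<phi>) summable_on UNIV"
    using f by (simp add: o_def)
  then have summ: "(\<lambda>\<gamma>. (norm (F \<gamma>))\<^sup>2) summable_on range \<phi>"
    by (simp add: summable_on_reindex[OF inj])
  have F_0: "F \<gamma> = 0" if "\<gamma> \<notin> range \<phi>" for \<gamma>
  proof (rule ccontr)
    assume "F \<gamma> \<noteq> 0"
    then have "\<gamma> i \<noteq> [] \<and> hd (\<gamma> i) = j" by (simp add: F_def split: if_splits)
    then have "\<gamma> = \<phi> (\<gamma>(i := tl (\<gamma> i)))" by (auto simp: \<phi>_def)
    then show False using that by blast
  qed
  have "(\<lambda>\<gamma>. (norm (F \<gamma>))\<^sup>2) summable_on range \<phi> \<longleftrightarrow> (\<lambda>\<gamma>. (norm (F \<gamma>))\<^sup>2) summable_on UNIV"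
    by (intro summable_on_cong_neutral) (simp_all add: F_0)
  then have "(\<lambda>\<gamma>. (norm (F \<gamma>))\<^sup>2) summable_on UNIV" using summ by blast
  then show "(\<lambda>\<gamma>. (norm (if \<gamma> i \<noteq> [] \<and> hd (\<gamma> i) = j then f (\<gamma>(i := tl (\<gamma> i))) else 0))\<^sup>2) summable_on UNIV"
    by (simp add: F_def)
qed

text \<open>The projection \<open>P\<^sup>(\<^sup>1\<^sup>)\<^bsub>q\<^sub>1\<^esub> \<otimes> \<cdots> \<otimes> P\<^sup>(\<^sup>k\<^sup>)\<^bsub>q\<^sub>k\<^esub> \<otimes> I\<close>, again polymorphic in the coefficient space.\<close>

lift_definition length_proj ::
    "nat \<Rightarrow> (nat \<Rightarrow> nat) \<Rightarrow> (multiword, 'a::complex_inner) l2 \<Rightarrow> (multiword, 'a) l2"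
  is "\<lambda>k q f \<gamma>. if \<forall>i\<in>{1..k}. length (\<gamma> i) = q i then f \<gamma> else 0"
  by (erule summable_on_comparison_test) auto

lemma cinner_basis_tensor:
  "cinner (basis_tensor \<beta> g) (basis_tensor \<gamma> h) = (if \<beta> = \<gamma> then cinner g h else 0)"
  for g h :: "'a::complex_inner"
proof -
  have zero: "cinner 0 y = 0" for y :: 'a
    using cinner_scaleC_left[of 0 0 y] by simp
  have zero': "cinner x 0 = 0" for x :: 'a
    using cinner_commute[of x 0] zero[of x] by simp
  have "cinner (basis_tensor \<beta> g) (basis_tensor \<gamma> h)
      = (\<Sum>\<^sub>\<infinity>x\<in>{\<beta>}. cinner (coord (basis_tensor \<beta> g) x) (coord (basis_tensor \<gamma> h) x))"
    unfolding cinner_l2_def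
    by (rule infsum_cong_neutral) (auto simp: basis_tensor.rep_eq zero)
  then show ?thesis by (auto simp: basis_tensor.rep_eq zero')
qed

lemma has_sum_basis_tensor: "((\<lambda>\<beta>. basis_tensor \<beta> (coord f \<beta>)) has_sum f) UNIV"
proof -
  have sq: "(norm ((\<Sum>\<beta>\<in>A. basis_tensor \<beta> (coord f \<beta>)) - f))\<^sup>2
      = (norm f)\<^sup>2 - (\<Sum>\<beta>\<in>A. (norm (coord f \<beta>))\<^sup>2)" if "finite A" for A
  proof -
    have c: "coord ((\<Sum>\<beta>\<in>A. basis_tensor \<beta> (coord f \<beta>)) - f) x = (if x \<in> A then 0 else - coord f x)" for x
      using that by (simp add: coord_diff coord_sum basis_tensor.rep_eq sum.delta)
    have "(norm ((\<Sum>\<beta>\<in>A. basis_tensor \<beta> (coord f \<beta>)) - f))\<^sup>2 = (\<Sum>\<^sub>\<infinity>x\<in>UNIV - A. (norm (coord f x))\<^sup>2)"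
      unfolding norm_l2_sq c by (rule infsum_cong_neutral) auto
    also have "\<dots> = (norm f)\<^sup>2 - (\<Sum>\<^sub>\<infinity>x\<in>A. (norm (coord f x))\<^sup>2)"
      unfolding norm_l2_sq using that by (intro infsum_Diff l2_summable) auto
    finally show ?thesis using that by simp
  qed
  have "((\<lambda>x. (norm (coord f x))\<^sup>2) has_sum (norm f)\<^sup>2) UNIV"
    using l2_summable[of f] by (simp add: norm_l2_sq)
  then have lim: "((\<lambda>A. \<Sum>x\<in>A. (norm (coord f x))\<^sup>2) \<longlongrightarrow> (norm f)\<^sup>2) (finite_subsets_at_top UNIV)"
    by (simp add: has_sum_def)
  have "((\<lambda>A. sqrt ((norm f)\<^sup>2 - (\<Sum>x\<in>A. (norm (coord f x))\<^sup>2))) \<longlongrightarrow> sqrt ((norm f)\<^sup>2 - (norm f)\<^sup>2))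
      (finite_subsets_at_top UNIV)"
    by (intro tendsto_intros lim)
  moreover have "\<forall>\<^sub>F A in finite_subsets_at_top UNIV.
      sqrt ((norm f)\<^sup>2 - (\<Sum>x\<in>A. (norm (coord f x))\<^sup>2)) = norm ((\<Sum>\<beta>\<in>A. basis_tensor \<beta> (coord f \<beta>)) - f)"
    by (rule eventually_finite_subsets_at_top_weakI) (simp add: sq[symmetric])
  ultimately have "((\<lambda>A. norm ((\<Sum>\<beta>\<in>A. basis_tensor \<beta> (coord f \<beta>)) - f)) \<longlongrightarrow> 0) (finite_subsets_at_top UNIV)"
    by (simp add: tendsto_cong)
  then show ?thesis
    unfolding has_sum_def by (simp add: tendsto_norm_zero_iff LIM_zero_iff)
qed

lemma creation_basis_tensor:
  "creation i j (basis_tensor \<beta> h) = basis_tensor (\<beta>(i := j # \<beta> i)) h"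
proof (rule l2_eqI)
  fix \<gamma> :: multiword
  have "\<gamma> i \<noteq> [] \<and> hd (\<gamma> i) = j \<and> \<gamma>(i := tl (\<gamma> i)) = \<beta> \<longleftrightarrow> \<gamma> = \<beta>(i := j # \<beta> i)"
    by (auto simp: fun_eq_iff split: if_splits) (metis list.collapse)+
  then show "coord (creation i j (basis_tensor \<beta> h)) \<gamma> = coord (basis_tensor (\<beta>(i := j # \<beta> i)) h) \<gamma>"
    by (simp add: creation.rep_eq basis_tensor.rep_eq) metis
qed

lemma length_proj_basis_tensor:
  "length_proj k q (basis_tensor \<beta> h)
     = (if \<forall>i\<in>{1..k}. length (\<beta> i) = q i then basis_tensor \<beta> h else 0)"
  by (rule l2_eqI) (auto simp: length_proj.rep_eq basis_tensor.rep_eq zero_l2.rep_eq)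


section \<open>Tuples of operators and curvature\<close>

text \<open>
  An element of \<open>B(G)\<^bsup>n\<^sub>1\<^esup> \<times> \<cdots> \<times> B(G)\<^bsup>n\<^sub>k\<^esup>\<close> is a function \<open>T\<close> with \<open>T i j\<close> for \<open>i \<in> {1..k}\<close> and
  \<open>j \<in> {1..n i}\<close> the \<open>j\<close>-th entry of the \<open>i\<close>-th tuple.
\<close>

definition cp_map :: "'a::chilbert_space set \<Rightarrow> nat \<Rightarrow> (nat \<Rightarrow> 'a \<Rightarrow> 'a) \<Rightarrow> ('a \<Rightarrow> 'a) \<Rightarrow> 'a \<Rightarrow> 'a" where
  "cp_map G m X Y = (\<lambda>x. \<Sum>j=1..m. X j (Y (adj G (X j) x)))"

text \<open>\<open>\<^bold>\<Delta>\<^sub>T(I) = (id - \<Phi>\<^bsub>T\<^sub>1\<^esub>) \<circ> \<cdots> \<circ> (id - \<Phi>\<^bsub>T\<^sub>k\<^esub>)(I)\<close>\<close>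

definition defect ::
    "nat \<Rightarrow> (nat \<Rightarrow> nat) \<Rightarrow> 'a::chilbert_space set \<Rightarrow> (nat \<Rightarrow> nat \<Rightarrow> 'a \<Rightarrow> 'a) \<Rightarrow> 'a \<Rightarrow> 'a" where
  "defect k n G T = foldr (\<lambda>i Y x. Y x - cp_map G (n i) (T i) Y x) [1..<Suc k] id"

definition finite_rank ::
    "nat \<Rightarrow> (nat \<Rightarrow> nat) \<Rightarrow> 'a::chilbert_space set \<Rightarrow> (nat \<Rightarrow> nat \<Rightarrow> 'a \<Rightarrow> 'a) \<Rightarrow> bool" where
  "finite_rank k n G T \<longleftrightarrow> finite_rank_op G (defect k n G T)"

definition word_op :: "(nat \<Rightarrow> 'a \<Rightarrow> 'a) \<Rightarrow> nat list \<Rightarrow> 'a \<Rightarrow> 'a" where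
  "word_op X \<alpha> = foldr (\<lambda>j A. X j \<circ> A) \<alpha> id"

text \<open>The values lie in \<open>fock k n D\<close>, where \<open>D\<close> is the closure of the range of the defect operator.\<close>

definition berezin_kernel ::
    "nat \<Rightarrow> (nat \<Rightarrow> nat) \<Rightarrow> 'a::chilbert_space set \<Rightarrow> (nat \<Rightarrow> nat \<Rightarrow> 'a \<Rightarrow> 'a) \<Rightarrow> 'a \<Rightarrow> (multiword, 'a) l2" where
  "berezin_kernel k n G T h =
     (\<Sum>\<^sub>\<infinity>\<beta>\<in>multiwords k n. basis_tensor \<beta>
        (sqrt_op G (defect k n G T)
          (foldr (\<lambda>i. adj G (word_op (T i) (\<beta> i))) [1..<Suc k] h)))"

text \<open>Both traces below are traces of positive operators, hence real and nonnegative.\<close>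

definition curv ::
    "nat \<Rightarrow> (nat \<Rightarrow> nat) \<Rightarrow> 'a::chilbert_space set \<Rightarrow> (nat \<Rightarrow> nat \<Rightarrow> 'a \<Rightarrow> 'a) \<Rightarrow> real" where
  "curv k n G T = lim (\<lambda>m.
     1 / real ((m + k) choose k) *
     (\<Sum>q \<in> {q \<in> {1..k} \<rightarrow>\<^sub>E UNIV. (\<Sum>i=1..k. q i) \<le> m}.
        Re (op_trace G (\<lambda>h. adj G (berezin_kernel k n G T) (length_proj k q (berezin_kernel k n G T h))))
        / Re (op_trace (fock k n (UNIV :: complex set)) (length_proj k q))))"


section \<open>Invariant subspaces\<close>

definition invariant_subspace :: "nat \<Rightarrow> (nat \<Rightarrow> nat) \<Rightarrow> (multiword, 'h::chilbert_space) l2 set \<Rightarrow> bool" where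
  "invariant_subspace k n V \<longleftrightarrow>
     closed_csubspace V \<and> V \<subseteq> fock k n UNIV \<and>
     (\<forall>i\<in>{1..k}. \<forall>j\<in>{1..n i}. creation i j ` V \<subseteq> V)"

definition reducing_subspace :: "nat \<Rightarrow> (nat \<Rightarrow> nat) \<Rightarrow> (multiword, 'h::chilbert_space) l2 set \<Rightarrow> bool" where
  "reducing_subspace k n V \<longleftrightarrow>
     invariant_subspace k n V \<and>
     (\<forall>i\<in>{1..k}. \<forall>j\<in>{1..n i}. adj (fock k n UNIV) (creation i j) ` V \<subseteq> V)"

definition multi_analytic ::
    "nat \<Rightarrow> (nat \<Rightarrow> nat) \<Rightarrow> 'e::chilbert_space set \<Rightarrow> 'h::chilbert_space set
      \<Rightarrow> ((multiword, 'e) l2 \<Rightarrow> (multiword, 'h) l2) \<Rightarrow> bool" where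
  "multi_analytic k n E H \<Psi> \<longleftrightarrow>
     bounded_op (fock k n E) (fock k n H) \<Psi> \<and>
     (\<forall>i\<in>{1..k}. \<forall>j\<in>{1..n i}. \<forall>f\<in>fock k n E. \<Psi> (creation i j f) = creation i j (\<Psi> f))"

definition inner_multi_analytic ::
    "nat \<Rightarrow> (nat \<Rightarrow> nat) \<Rightarrow> 'e::chilbert_space set \<Rightarrow> 'h::chilbert_space set
      \<Rightarrow> ((multiword, 'e) l2 \<Rightarrow> (multiword, 'h) l2) \<Rightarrow> bool" where
  "inner_multi_analytic k n E H \<Psi> \<longleftrightarrow> multi_analytic k n E H \<Psi> \<and> partial_isometry (fock k n E) \<Psi>"

text \<open>
  HOL cannot quantify over the type carrying the Hilbert space \<open>E\<close> inside a formula, so that type is a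
  parameter. In a hypothesis, a free type variable in this place expresses precisely the existence of
  some Hilbert space \<open>E\<close>.
\<close>

definition beurling_type ::
    "'e::chilbert_space itself \<Rightarrow> nat \<Rightarrow> (nat \<Rightarrow> nat) \<Rightarrow> (multiword, 'h::chilbert_space) l2 set \<Rightarrow> bool" where
  "beurling_type _ k n M \<longleftrightarrow>
     (\<exists>(E :: 'e set) \<Psi>. closed_csubspace E \<and> inner_multi_analytic k n E UNIV \<Psi> \<and> M = \<Psi> ` fock k n E)"

definition unitarily_equivalent ::
    "nat \<Rightarrow> (nat \<Rightarrow> nat) \<Rightarrow> (multiword, 'h::chilbert_space) l2 set \<Rightarrow> (multiword, 'h) l2 set \<Rightarrow> bool" where
  "unitarily_equivalent k n M N \<longleftrightarrow>
     (\<exists>U. unitary_op M N U \<and>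
          (\<forall>i\<in>{1..k}. \<forall>j\<in>{1..n i}. \<forall>f\<in>M. U (creation i j f) = creation i j (U f)))"

end

theory Submission
  imports Defs
begin

text \<open>
  The orthogonal complement of the kernel of an inner multi-analytic operator is reducing, hence of the
  form \<open>fock k n E\<close>. So a Beurling type subspace \<open>M\<close>, together with the creation operators on it, is
  unitarily equivalent to \<open>fock k n E\<close>; finite rank means \<open>dim E < \<infinity>\<close>. In this model the defect operator
  is the projection onto the vacuum vectors, the Berezin kernel is an isometric embedding, and every
  quotient of traces in the definition of the curvature equals \<open>dim E\<close>. Hence the curvature is
  \<open>dim E\<close>, which is also the complete unitary invariant of \<open>fock k n E\<close>.
\<close>

section \<open>Orthonormal sets and orthogonal projections\<close>

text \<open>The trace is taken in some chosen orthonormal basis and the square root of the defect is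
  some chosen positive root. The computation therefore needs Parseval's identity in an arbitrary
  orthonormal basis, and uniqueness of the positive root, which is proved only for projections. The
  coefficient spaces of \<open>M\<close> and \<open>N\<close> may live in different types. They are
  compared through finite orthonormal bases \<open>W\<close> and \<open>W'\<close>: a bijection
  between these induces a unitary between the two Fock spaces. No asymptotics enters the curvature.
  The average runs over exactly \<open>(m + k) choose k\<close> multi-degrees and each contributes
  \<open>card W\<close>, so the sequence is constant in \<open>m\<close>. Invariance of the
  curvature under unitary equivalence is also free: composing a model of \<open>M\<close> with a
  unitary from \<open>M\<close> onto \<open>N\<close> gives a model of \<open>N\<close> over the
  same \<open>W\<close>.\<close>

lemma cinner_scaleC_right: "cinner x (c *\<^sub>C y) = cnj c * cinner x y" for x y :: "'a::complex_inner"
  by (subst cinner_commute) (simp add: cinner_scaleC_left cinner_commute[of x y])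

lemma cinner_add_right: "cinner x (y + z) = cinner x y + cinner x z" for x y z :: "'a::complex_inner"
  by (subst cinner_commute) (simp add: cinner_add_left cinner_commute[of x])

lemma cinner_zero_left [simp]: "cinner 0 x = 0" for x :: "'a::complex_inner"
  using cinner_add_left[of 0 0 x] by simp

lemma cinner_zero_right [simp]: "cinner x 0 = 0" for x :: "'a::complex_inner"
  using cinner_add_right[of x 0 0] by simp

lemma cinner_diff_left: "cinner (x - y) z = cinner x z - cinner y z" for x y z :: "'a::complex_inner"
  using cinner_add_left[of "x - y" y z] by simp

lemma cinner_diff_right: "cinner x (y - z) = cinner x y - cinner x z" for x y z :: "'a::complex_inner"
  using cinner_add_right[of x "y - z" z] by simp

lemma cinner_sum_left: "cinner (\<Sum>i\<in>I. f i) x = (\<Sum>i\<in>I. cinner (f i) x)"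
  for x :: "'a::complex_inner"
  by (induction I rule: infinite_finite_induct) (simp_all add: cinner_add_left)

lemma cinner_sum_right: "cinner x (\<Sum>i\<in>I. f i) = (\<Sum>i\<in>I. cinner x (f i))"
  for x :: "'a::complex_inner"
  by (induction I rule: infinite_finite_induct) (simp_all add: cinner_add_right)

lemma cinner_mult_cnj: "cinner x y * cinner y x = of_real ((cmod (cinner x y))\<^sup>2)"
  for x y :: "'a::complex_inner"
  by (simp only: complex_norm_square cinner_commute[of y x])

lemma bounded_linear_cinner_left: "bounded_linear (\<lambda>x. cinner x y)" for y :: "'a::complex_inner"
proof (rule bounded_linear_intro[where K = "2 * norm y"])
  show "cinner (r *\<^sub>R x) y = r *\<^sub>R cinner x y" for r x
    by (simp add: scaleR_scaleC[of r x] cinner_scaleC_left scaleR_conv_of_real)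
  show "norm (cinner x y) \<le> norm x * (2 * norm y)" for x
    using cmod_cinner_le[of x y] by (simp add: mult_ac)
qed (rule cinner_add_left)

lemma pythagoras: "cinner x y = 0 \<Longrightarrow> (norm (x + y))\<^sup>2 = (norm x)\<^sup>2 + (norm y)\<^sup>2"
  for x y :: "'a::complex_inner"
  by (simp add: power2_norm_eq_inner inner_add_left inner_add_right inner_eq_Re_cinner[of x y] inner_commute)

text \<open>Supplies the uniqueness required by the definite description in \<open>adj\<close>: test
  with \<open>z = x - y\<close>.\<close>

lemma eq_if_cinner_eq:
  fixes x y :: "'a::complex_inner"
  assumes "csubspace G" "x \<in> G" "y \<in> G" "\<And>z. z \<in> G \<Longrightarrow> cinner z x = cinner z y"
  shows "x = y"
proof -
  have "x - y \<in> G" using assms complex_vector.subspace_diff by blast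
  then have "cinner (x - y) (x - y) = 0" using assms(4) by (simp add: cinner_diff_right)
  then show ?thesis by (simp add: cinner_self)
qed

section \<open>The projection theorem\<close>

lemma csubspace_scaleR: "csubspace K \<Longrightarrow> x \<in> K \<Longrightarrow> r *\<^sub>R x \<in> K"
  by (simp add: scaleR_scaleC complex_vector.subspace_scale)

text \<open>A minimizing sequence for the distance from \<open>x\<close> to \<open>K\<close> is
  Cauchy by the parallelogram law, and a variation argument makes its limit the orthogonal
  projection. It is applied later to the kernel of a multi-analytic operator.\<close>

lemma orthogonal_projection_exists:
  fixes K :: "'a::chilbert_space set"
  assumes K: "closed_csubspace K"
  shows "\<exists>y\<in>K. \<forall>z\<in>K. cinner (x - y) z = 0"
proof -
  have sub: "csubspace K" and cl: "closed K" using K by (auto simp: closed_csubspace_def)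
  have ne: "K \<noteq> {}" using complex_vector.subspace_0[OF sub] by blast
  define d where "d = infdist x K"
  have d_le: "d \<le> norm (x - z)" if "z \<in> K" for z
    using infdist_le[OF that, of x] by (simp add: d_def dist_norm)
  have d0: "0 \<le> d" by (simp add: d_def infdist_nonneg)
  have "\<exists>z\<in>K. norm (x - z) < d + 1 / real (Suc m)" for m
    using cInf_lessD[of "dist x ` K" "d + 1 / real (Suc m)"] ne
    by (auto simp: d_def infdist_notempty dist_norm)
  then obtain y where y: "\<And>m. y m \<in> K" "\<And>m. norm (x - y m) < d + 1 / real (Suc m)" by metis
  have "(\<lambda>m. d + 1 / real (Suc m)) \<longlonglongrightarrow> d + 0"
    by (intro tendsto_intros LIMSEQ_Suc lim_1_over_n)
  then have lim: "(\<lambda>m. norm (x - y m)) \<longlonglongrightarrow> d"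
    by (intro tendsto_sandwich[of "\<lambda>_. d" "\<lambda>m. norm (x - y m)" sequentially "\<lambda>m. d + 1 / real (Suc m)"])
       (use d_le y in \<open>auto intro!: always_eventually less_imp_le\<close>)
  \<comment> \<open>Parallelogram law for \<open>x - y m\<close> and \<open>x - y l\<close>. The
    midpoint of \<open>y m\<close> and \<open>y l\<close> lies in \<open>K\<close>, hence has
    distance at least \<open>d\<close> from \<open>x\<close>.\<close>
  have par: "(norm (y m - y l))\<^sup>2 \<le> 2 * ((norm (x - y m))\<^sup>2 - d\<^sup>2) + 2 * ((norm (x - y l))\<^sup>2 - d\<^sup>2)" for m l
  proof -
    have "(1/2) *\<^sub>R (y m + y l) \<in> K"
      by (intro csubspace_scaleR[OF sub] complex_vector.subspace_add[OF sub] y)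
    then have "d\<^sup>2 \<le> (norm (x - (1/2) *\<^sub>R (y m + y l)))\<^sup>2" using d_le d0 by (intro power_mono)
    also have "4 * \<dots> = (norm ((x - y m) + (x - y l)))\<^sup>2"
    proof -
      have "(x - y m) + (x - y l) = 2 *\<^sub>R (x - (1/2) *\<^sub>R (y m + y l))"
        by (simp add: algebra_simps) (simp add: scaleR_2)
      then show ?thesis by (simp add: power_mult_distrib)
    qed
    moreover have "(norm ((x - y m) + (x - y l)))\<^sup>2 + (norm (y m - y l))\<^sup>2
        = 2 * (norm (x - y m))\<^sup>2 + 2 * (norm (x - y l))\<^sup>2"
      by (simp add: power2_norm_eq_inner inner_add_left inner_add_right inner_diff_left inner_diff_right
          inner_commute algebra_simps)
    ultimately show ?thesis by argo
  qed
  have sq: "(\<lambda>m. (norm (x - y m))\<^sup>2 - d\<^sup>2) \<longlonglongrightarrow> 0"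
    using tendsto_diff[OF tendsto_power[OF lim, of 2] tendsto_const[of "d\<^sup>2"]] by simp
  \<comment> \<open>The bound \<open>par\<close> has two terms with factor 2 each, hence the
    tolerance \<open>c / 4\<close>.\<close>
  have ar: "u < c" if "u \<le> 2 * a + 2 * b" "a < c / 4" "b < c / 4" for a b c u :: real
    using that by linarith
  have "Cauchy y"
  proof (rule metric_CauchyI)
    fix e :: real assume "0 < e"
    then have "\<forall>\<^sub>F m in sequentially. (norm (x - y m))\<^sup>2 - d\<^sup>2 < e\<^sup>2 / 4"
      by (intro order_tendstoD(2)[OF sq]) simp
    then obtain M where M: "\<And>m. m \<ge> M \<Longrightarrow> (norm (x - y m))\<^sup>2 - d\<^sup>2 < e\<^sup>2 / 4"
      by (auto simp: eventually_sequentially)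
    have "dist (y m) (y l) < e" if "m \<ge> M" "l \<ge> M" for m l
    proof -
      have "(norm (y m - y l))\<^sup>2 < e\<^sup>2" using ar[OF par M M] that by blast
      then show ?thesis using \<open>0 < e\<close> by (simp add: dist_norm power2_less_imp_less)
    qed
    then show "\<exists>M. \<forall>m\<ge>M. \<forall>n\<ge>M. dist (y m) (y n) < e" by blast
  qed
  then obtain p where p: "y \<longlonglongrightarrow> p" by (auto simp: Cauchy_convergent_iff convergent_def)
  have pK: "p \<in> K" using closed_sequentially[OF cl y(1) p] .
  have "(\<lambda>m. norm (x - y m)) \<longlonglongrightarrow> norm (x - p)" by (intro tendsto_intros p)
  then have np: "norm (x - p) = d" using lim LIMSEQ_unique by blast
  have orth: "inner (x - p) z = 0" if z: "z \<in> K" for z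
  proof (rule ccontr)
    assume nz: "inner (x - p) z \<noteq> 0"
    then have zp: "0 < inner z z" by auto
    \<comment> \<open>The minimizer of the norm of \<open>(x - p) - t *\<^sub>R z\<close>. It lowers
      the squared norm by \<open>(inner (x - p) z)\<^sup>2 / inner z z\<close>, which contradicts
      the minimality of \<open>norm (x - p)\<close>.\<close>
    define t where "t = inner (x - p) z / inner z z"
    have "p + t *\<^sub>R z \<in> K"
      by (intro complex_vector.subspace_add[OF sub] csubspace_scaleR[OF sub] pK z)
    then have "norm (x - p) \<le> norm (x - (p + t *\<^sub>R z))" using d_le np by simp
    then have "(norm (x - p))\<^sup>2 \<le> (norm (x - (p + t *\<^sub>R z)))\<^sup>2" by (intro power_mono) auto
    also have "x - (p + t *\<^sub>R z) = (x - p) - t *\<^sub>R z" by simp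
    also have "(norm ((x - p) - t *\<^sub>R z))\<^sup>2 = (norm (x - p))\<^sup>2 - 2 * t * inner (x - p) z + t\<^sup>2 * inner z z"
      unfolding power2_norm_eq_inner
      by (simp add: inner_diff_left inner_diff_right inner_commute power2_eq_square algebra_simps)
    also have "\<dots> = (norm (x - p))\<^sup>2 - (inner (x - p) z)\<^sup>2 / inner z z"
      using zp by (simp add: t_def power2_eq_square field_simps)
    finally have "\<not> 0 < (inner (x - p) z)\<^sup>2 / inner z z" by linarith
    moreover have "0 < (inner (x - p) z)\<^sup>2 / inner z z"
      by (rule divide_pos_pos) (use nz zp in simp_all)
    ultimately show False by blast
  qed
  \<comment> \<open>Real orthogonality to \<open>z\<close> gives the real part, and to
    \<open>\<i> *\<^sub>C z\<close> the imaginary part.\<close>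
  have "cinner (x - p) z = 0" if "z \<in> K" for z
    using orth[OF that] orth[OF complex_vector.subspace_scale[OF sub that, of \<i>]]
    by (intro complex_eqI) (simp_all add: Im_cinner inner_eq_Re_cinner[symmetric])
  then show ?thesis using pK by blast
qed

section \<open>Orthonormal systems, Parseval's identity and finite bases\<close>

definition orthonormal :: "'a::complex_inner set \<Rightarrow> bool" where
  "orthonormal W \<longleftrightarrow> (\<forall>x\<in>W. \<forall>y\<in>W. cinner x y = (if x = y then 1 else 0))"

lemma orthonormal_subset: "orthonormal W \<Longrightarrow> A \<subseteq> W \<Longrightarrow> orthonormal A"
  unfolding orthonormal_def by blast

lemma cinner_orthonormal_sum:
  assumes "finite W" "orthonormal W" "w \<in> W"
  shows "cinner (\<Sum>v\<in>W. c v *\<^sub>C v) w = c w"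
proof -
  have "cinner (\<Sum>v\<in>W. c v *\<^sub>C v) w = (\<Sum>v\<in>W. if v = w then c v else 0)"
    unfolding cinner_sum_left using assms(2,3)
    by (intro sum.cong) (auto simp: cinner_scaleC_left orthonormal_def)
  then show ?thesis using assms by (simp add: sum.delta)
qed

lemma orthonormal_expansion:
  assumes "finite W" "orthonormal W" "x \<in> cspan W"
  shows "(\<Sum>w\<in>W. cinner x w *\<^sub>C w) = x"
proof -
  obtain c where x: "x = (\<Sum>v\<in>W. c v *\<^sub>C v)"
    using assms(3) unfolding complex_vector.span_finite[OF assms(1)] by blast
  show ?thesis
    using cinner_orthonormal_sum[OF assms(1,2), of _ c] unfolding x by (intro sum.cong) auto
qed

lemma orthonormal_parseval_finite:
  assumes "finite W" "orthonormal W" "x \<in> cspan W"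
  shows "cinner x y = (\<Sum>w\<in>W. cinner x w * cinner w y)"
  by (subst orthonormal_expansion[OF assms, symmetric]) (simp add: cinner_sum_left cinner_scaleC_left)

lemma residual_orthogonal:
  assumes "finite W" "orthonormal W" "y \<in> cspan W"
  shows "cinner (x - (\<Sum>w\<in>W. cinner x w *\<^sub>C w)) y = 0"
proof -
  have "cinner (x - (\<Sum>v\<in>W. cinner x v *\<^sub>C v)) w = 0" if "w \<in> W" for w
    using cinner_orthonormal_sum[OF assms(1,2) that, of "cinner x"] by (simp add: cinner_diff_left)
  then show ?thesis
    by (subst orthonormal_expansion[OF assms, symmetric]) (simp add: cinner_sum_right cinner_scaleC_right)
qed

lemma norm_residual:
  assumes "finite W" "orthonormal W"
  shows "(norm (x - (\<Sum>w\<in>W. cinner x w *\<^sub>C w)))\<^sup>2 = (norm x)\<^sup>2 - (\<Sum>w\<in>W. (cmod (cinner x w))\<^sup>2)"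
proof -
  define p where "p = (\<Sum>w\<in>W. cinner x w *\<^sub>C w)"
  have p: "p \<in> cspan W"
    unfolding p_def by (intro complex_vector.span_sum complex_vector.span_scale complex_vector.span_base)
  have w: "cinner p w = cinner x w" if "w \<in> W" for w
    unfolding p_def by (rule cinner_orthonormal_sum[OF assms that])
  have "(norm x)\<^sup>2 = (norm (x - p))\<^sup>2 + (norm p)\<^sup>2"
    using pythagoras[OF residual_orthogonal[OF assms p, of x, folded p_def]] by simp
  moreover have "complex_of_real ((norm p)\<^sup>2) = of_real (\<Sum>w\<in>W. (cmod (cinner x w))\<^sup>2)"
    unfolding cinner_self[of p, symmetric] orthonormal_parseval_finite[OF assms p, of p] cinner_mult_cnj
    by (simp add: w)
  then have "(norm p)\<^sup>2 = (\<Sum>w\<in>W. (cmod (cinner x w))\<^sup>2)"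
    unfolding of_real_eq_iff .
  ultimately show ?thesis by (simp add: p_def)
qed

text \<open>By \<open>norm_residual\<close> the partial sum over a finite set falls short of
  \<open>(norm x)\<^sup>2\<close> by the squared distance from \<open>x\<close> to the span of that
  set. This distance is at most the one to an approximant \<open>y\<close> from the span of
  \<open>F\<close>, and stays so for every larger finite set.\<close>

lemma parseval:
  assumes B: "orthonormal_basis G B" and x: "x \<in> G"
  shows "((\<lambda>e. (cmod (cinner x e))\<^sup>2) has_sum (norm x)\<^sup>2) B"
proof -
  have on: "orthonormal B" and cl: "closure (cspan B) = G"
    using B by (auto simp: orthonormal_basis_def orthonormal_def)
  have res: "(\<Sum>e\<in>F. (cmod (cinner x e))\<^sup>2) = (norm x)\<^sup>2 - (norm (x - (\<Sum>e\<in>F. cinner x e *\<^sub>C e)))\<^sup>2"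
    if "finite F" "F \<subseteq> B" for F
    using norm_residual[OF that(1) orthonormal_subset[OF on that(2)], of x] by simp
  show ?thesis
    unfolding has_sum_def tendsto_iff eventually_finite_subsets_at_top
  proof (intro allI impI)
    fix \<epsilon> :: real assume "0 < \<epsilon>"
    then have "0 < sqrt \<epsilon>" by simp
    moreover have "\<forall>e>0. \<exists>y\<in>cspan B. dist y x < e"
      using x unfolding cl[symmetric] closure_approachable .
    ultimately obtain y where y: "y \<in> cspan B" "dist y x < sqrt \<epsilon>" by blast
    obtain F c where F: "finite F" "F \<subseteq> B" and yF: "y = (\<Sum>a\<in>F. c a *\<^sub>C a)"
      using y(1) unfolding complex_vector.span_explicit by blast
    have "dist (\<Sum>e\<in>F'. (cmod (cinner x e))\<^sup>2) ((norm x)\<^sup>2) < \<epsilon>" if F': "finite F'" "F \<subseteq> F'" "F' \<subseteq> B" for F'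
    proof -
      note on' = orthonormal_subset[OF on F'(3)]
      define p where "p = (\<Sum>e\<in>F'. cinner x e *\<^sub>C e)"
      have "y \<in> cspan F'" unfolding yF using F'(2)
        by (intro complex_vector.span_sum complex_vector.span_scale complex_vector.span_base) auto
      moreover have "p \<in> cspan F'" unfolding p_def
        by (intro complex_vector.span_sum complex_vector.span_scale complex_vector.span_base)
      ultimately have "p - y \<in> cspan F'" by (intro complex_vector.span_diff)
      from pythagoras[OF residual_orthogonal[OF F'(1) on' this, of x, folded p_def]]
      have "(norm (x - p))\<^sup>2 \<le> (norm (x - y))\<^sup>2" by simp
      also have "\<dots> < (sqrt \<epsilon>)\<^sup>2" using y(2) by (intro power_strict_mono) (auto simp: dist_norm norm_minus_commute)
      finally show ?thesis using \<open>0 < \<epsilon>\<close> res[OF F'(1,3)] by (simp add: dist_real_def p_def)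
    qed
    then show "\<exists>X. finite X \<and> X \<subseteq> B \<and>
        (\<forall>Y. finite Y \<and> X \<subseteq> Y \<and> Y \<subseteq> B \<longrightarrow> dist (\<Sum>e\<in>Y. (cmod (cinner x e))\<^sup>2) ((norm x)\<^sup>2) < \<epsilon>)"
      using F(1,2) by (intro exI[of _ F] conjI allI impI) auto
  qed
qed

lemma bounded_linear_scaleC_left: "bounded_linear (\<lambda>c. c *\<^sub>C x)" for x :: "'a::complex_inner"
proof (rule bounded_linear_intro[where K = "norm x"])
  show "(r *\<^sub>R c) *\<^sub>C x = r *\<^sub>R (c *\<^sub>C x)" for r and c :: complex
    by (simp only: scaleR_scaleC[of r "c *\<^sub>C x"] scaleC_scaleC scaleR_conv_of_real)
qed (simp_all add: scaleC_add_left norm_scaleC)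

text \<open>The span is the fixed-point set of the orthogonal projection onto it, which is
  continuous.\<close>

lemma closed_cspan_orthonormal:
  assumes "finite W" "orthonormal W"
  shows "closed (cspan W)"
proof -
  have "(\<Sum>w\<in>W. cinner x w *\<^sub>C w) \<in> cspan W" for x
    by (intro complex_vector.span_sum complex_vector.span_scale complex_vector.span_base)
  then have eq: "cspan W = {x. (\<Sum>w\<in>W. cinner x w *\<^sub>C w) = x}"
    using orthonormal_expansion[OF assms] by (metis (mono_tags, lifting) Collect_cong Collect_mem_eq)
  show ?thesis
    unfolding eq
    by (intro closed_Collect_eq continuous_intros continuous_on_id
        linear_continuous_on bounded_linear_compose[OF bounded_linear_scaleC_left bounded_linear_cinner_left])
qed

lemma orthonormal_independent:
  assumes "orthonormal W"
  shows "\<not> complex_vector.dependent W"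
proof
  assume "complex_vector.dependent W"
  then obtain T c v where T: "finite T" "T \<subseteq> W" "v \<in> T" "c v \<noteq> 0" "(\<Sum>v\<in>T. c v *\<^sub>C v) = 0"
    unfolding complex_vector.dependent_explicit by blast
  then show False
    using cinner_orthonormal_sum[OF T(1) orthonormal_subset[OF assms T(2)] T(3), of c] by simp
qed

text \<open>The bound \<open>m\<close> yields an orthonormal set of maximal cardinality. It spans,
  since a vector outside its span would provide one more orthonormal vector by a Gram-Schmidt
  step.\<close>

lemma orthonormal_spanning_set:
  assumes E: "csubspace E"
    and bd: "\<And>A. finite A \<Longrightarrow> orthonormal A \<Longrightarrow> A \<subseteq> E \<Longrightarrow> card A \<le> m"
  shows "\<exists>W. finite W \<and> orthonormal W \<and> cspan W = E"
proof -
  define P where "P = (\<lambda>A. finite A \<and> orthonormal A \<and> A \<subseteq> E)"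
  have "P {}" by (simp add: P_def orthonormal_def)
  moreover have "card A < Suc m" if "P A" for A using bd that by (simp add: P_def less_Suc_eq_le)
  ultimately obtain W where W: "P W" and max: "\<And>A. P A \<Longrightarrow> card A \<le> card W"
    using ex_has_greatest_nat[of P "{}" card "Suc m"] by (metis less_imp_le)
  then have fin: "finite W" and on: "orthonormal W" and sub: "W \<subseteq> E" by (auto simp: P_def)
  have "x \<in> cspan W" if x: "x \<in> E" for x
  proof (rule ccontr)
    assume nx: "x \<notin> cspan W"
    define p where "p = (\<Sum>w\<in>W. cinner x w *\<^sub>C w)"
    have p: "p \<in> cspan W"
      unfolding p_def by (intro complex_vector.span_sum complex_vector.span_scale complex_vector.span_base)
    then have pE: "p \<in> E" using complex_vector.span_minimal[OF sub E] by blast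
    have nz: "x - p \<noteq> 0" using p nx by auto
    define u where "u = complex_of_real (1 / norm (x - p)) *\<^sub>C (x - p)"
    have uE: "u \<in> E"
      unfolding u_def by (intro complex_vector.subspace_scale[OF E] complex_vector.subspace_diff[OF E] x pE)
    have uw: "cinner u w = 0" if "w \<in> W" for w
      using residual_orthogonal[OF fin on complex_vector.span_base[OF that], of x]
      by (simp add: u_def p_def cinner_scaleC_left)
    have "norm u = 1" using nz by (simp add: u_def norm_scaleC norm_divide)
    then have uu: "cinner u u = 1" by (simp add: cinner_self)
    have "u \<notin> W" using uw uu by force
    moreover have "cinner w u = 0" if "w \<in> W" for w using cinner_commute[of w u] uw[OF that] by simp
    then have "P (insert u W)"
      using fin on sub uE uw uu unfolding P_def orthonormal_def by auto
    ultimately show False using max[of "insert u W"] fin by simp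
  qed
  then have "cspan W = E" using complex_vector.span_minimal[OF sub E] by blast
  then show ?thesis using fin on by blast
qed

lemma card_orthonormal_le:
  assumes "finite B" "orthonormal A" "A \<subseteq> cspan B"
  shows "card A \<le> card B"
  using complex_vector.independent_span_bound[OF assms(1) orthonormal_independent[OF assms(2)] assms(3)] by simp

section \<open>Lowering operators on the Fock space\<close>

text \<open>The adjoint of \<open>word_op (creation i) \<alpha>\<close>.\<close>

lift_definition lower :: "nat \<Rightarrow> nat list \<Rightarrow> (multiword, 'a::complex_inner) l2 \<Rightarrow> (multiword, 'a) l2"
  is "\<lambda>i \<alpha> f \<gamma>. f (\<gamma>(i := \<alpha> @ \<gamma> i))"
proof -
  fix i \<alpha> and f :: "multiword \<Rightarrow> 'a"
  assume f: "(\<lambda>\<gamma>. (norm (f \<gamma>))\<^sup>2) summable_on UNIV"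
  define \<phi> where "\<phi> = (\<lambda>\<gamma> :: multiword. \<gamma>(i := \<alpha> @ \<gamma> i))"
  have inj: "inj \<phi>"
    by (rule inj_on_inverseI[of _ "\<lambda>\<gamma>. \<gamma>(i := drop (length \<alpha>) (\<gamma> i))"]) (simp add: \<phi>_def)
  have "(\<lambda>\<gamma>. (norm (f \<gamma>))\<^sup>2) summable_on range \<phi>"
    using f by (rule summable_on_subset_banach) simp
  then have "((\<lambda>\<gamma>. (norm (f \<gamma>))\<^sup>2) \<circ> \<phi>) summable_on UNIV"
    by (simp only: summable_on_reindex[OF inj])
  then show "(\<lambda>\<gamma>. (norm (f (\<gamma>(i := \<alpha> @ \<gamma> i))))\<^sup>2) summable_on UNIV"
    by (simp add: o_def \<phi>_def)
qed

text \<open>The product over \<open>i\<close> in \<open>I\<close> of the projections onto the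
  components whose \<open>i\<close>-th word is empty. Allowing a partial set \<open>I\<close> lets
  the defect be computed one tensor factor at a time.\<close>

lift_definition vacuum_proj :: "nat set \<Rightarrow> (multiword, 'a::complex_inner) l2 \<Rightarrow> (multiword, 'a) l2"
  is "\<lambda>I f \<gamma>. if \<forall>i\<in>I. \<gamma> i = [] then f \<gamma> else 0"
  by (erule summable_on_comparison_test) auto

text \<open>Index tuples are extensional, so the vacuum index has to be restricted to
  \<open>{1..k}\<close> in order to lie in \<open>multiwords k n\<close>.\<close>

definition empty_word :: "nat \<Rightarrow> multiword" where
  "empty_word k = (\<lambda>i\<in>{1..k}. [])"

section \<open>Index tuples and Fock subspaces\<close>

lemma multiwords_iff:
  "\<gamma> \<in> multiwords k n \<longleftrightarrow>
    (\<forall>i\<in>{1..k}. set (\<gamma> i) \<subseteq> {1..n i}) \<and> (\<forall>i. i \<notin> {1..k} \<longrightarrow> \<gamma> i = undefined)"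
  unfolding multiwords_def PiE_iff extensional_def lists_eq_set by blast

lemma empty_word_multiwords [simp]: "empty_word k \<in> multiwords k n"
  by (simp add: empty_word_def multiwords_iff)

lemma set_multiword: "\<gamma> \<in> multiwords k n \<Longrightarrow> i \<in> {1..k} \<Longrightarrow> set (\<gamma> i) \<subseteq> {1..n i}"
  by (simp add: multiwords_iff)

lemma multiwords_upd:
  assumes "\<gamma> \<in> multiwords k n" "i \<in> {1..k}" "set \<alpha> \<subseteq> {1..n i}"
  shows "\<gamma>(i := \<alpha>) \<in> multiwords k n"
  using assms unfolding multiwords_iff by (metis fun_upd_apply)

text \<open>Both directions matter for \<open>lower_fock\<close>: one preserves the values in
  \<open>E\<close> on multiwords, the other the vanishing elsewhere.\<close>

lemma multiwords_upd_iff: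
  assumes "i \<in> {1..k}" "set \<alpha> \<subseteq> {1..n i}"
  shows "\<gamma>(i := \<alpha> @ \<gamma> i) \<in> multiwords k n \<longleftrightarrow> \<gamma> \<in> multiwords k n"
proof
  assume a: "\<gamma>(i := \<alpha> @ \<gamma> i) \<in> multiwords k n"
  have "set (\<alpha> @ \<gamma> i) \<subseteq> {1..n i}" using set_multiword[OF a assms(1)] by simp
  then have "(\<gamma>(i := \<alpha> @ \<gamma> i))(i := \<gamma> i) \<in> multiwords k n"
    by (intro multiwords_upd[OF a assms(1)]) simp
  then show "\<gamma> \<in> multiwords k n" by simp
next
  assume a: "\<gamma> \<in> multiwords k n"
  show "\<gamma>(i := \<alpha> @ \<gamma> i) \<in> multiwords k n"
    by (rule multiwords_upd[OF a assms(1)]) (use set_multiword[OF a assms(1)] assms(2) in simp)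
qed

lemma coord_scaleC: "coord (c *\<^sub>C f) x = c *\<^sub>C coord f x"
  by (simp add: scaleC_l2.rep_eq)

lemma csubspace_fock: "csubspace E \<Longrightarrow> csubspace (fock k n E)"
  unfolding complex_vector.subspace_def
  by (auto simp: fock_def zero_l2.rep_eq plus_l2.rep_eq coord_scaleC)

lemma fock_mono: "E \<subseteq> E' \<Longrightarrow> fock k n E \<subseteq> fock k n E'"
  by (auto simp: fock_def)

lemma basis_tensor_fock: "csubspace E \<Longrightarrow> \<beta> \<in> multiwords k n \<Longrightarrow> e \<in> E \<Longrightarrow> basis_tensor \<beta> e \<in> fock k n E"
  using complex_vector.subspace_0 by (auto simp: fock_def basis_tensor.rep_eq)

lemma lower_fock:
  assumes "i \<in> {1..k}" "set \<alpha> \<subseteq> {1..n i}" "f \<in> fock k n E"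
  shows "lower i \<alpha> f \<in> fock k n E"
  using assms(3) multiwords_upd_iff[where n = n, OF assms(1,2)] unfolding fock_def by (simp add: lower.rep_eq)

lemma creation_fock:
  assumes "csubspace E" "i \<in> {1..k}" "j \<in> {1..n i}" "f \<in> fock k n E"
  shows "creation i j f \<in> fock k n E"
proof -
  have "\<gamma>(i := tl (\<gamma> i)) \<in> multiwords k n \<longleftrightarrow> \<gamma> \<in> multiwords k n" if "\<gamma> i \<noteq> []" "hd (\<gamma> i) = j" for \<gamma>
  proof -
    have "(\<gamma>(i := tl (\<gamma> i)))(i := [j] @ (\<gamma>(i := tl (\<gamma> i))) i) = \<gamma>"
      using that by (auto simp: fun_eq_iff)
    then show ?thesis
      using multiwords_upd_iff[of i k "[j]" n "\<gamma>(i := tl (\<gamma> i))"] assms(2,3) by simp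
  qed
  then show ?thesis
    using assms(4) complex_vector.subspace_0[OF assms(1)]
    unfolding fock_def by (simp add: creation.rep_eq)
qed

text \<open>\<open>creation i j f\<close> is carried by the range of the injection that prefixes
  \<open>j\<close> to the \<open>i\<close>-th word; reindexing the sum along it turns creation into
  lowering.\<close>

lemma cinner_creation: "cinner (creation i j f) g = cinner f (lower i [j] g)"
proof -
  define \<phi> where "\<phi> = (\<lambda>\<gamma> :: multiword. \<gamma>(i := j # \<gamma> i))"
  have inj: "inj \<phi>"
    by (rule inj_on_inverseI[of _ "\<lambda>\<gamma>. \<gamma>(i := tl (\<gamma> i))"]) (simp add: \<phi>_def)
  have F_0: "coord (creation i j f) \<gamma> = 0" if "\<gamma> \<notin> range \<phi>" for \<gamma>
  proof (rule ccontr)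
    assume "coord (creation i j f) \<gamma> \<noteq> 0"
    then have "\<gamma> i \<noteq> [] \<and> hd (\<gamma> i) = j" by (simp add: creation.rep_eq split: if_splits)
    then have "\<gamma> = \<phi> (\<gamma>(i := tl (\<gamma> i)))" by (auto simp: \<phi>_def)
    then show False using that by blast
  qed
  have "cinner (creation i j f) g = (\<Sum>\<^sub>\<infinity>\<gamma>\<in>range \<phi>. cinner (coord (creation i j f) \<gamma>) (coord g \<gamma>))"
    unfolding cinner_l2_def by (rule infsum_cong_neutral) (auto simp: F_0)
  also have "\<dots> = (\<Sum>\<^sub>\<infinity>\<gamma>. cinner (coord (creation i j f) (\<phi> \<gamma>)) (coord g (\<phi> \<gamma>)))"
    by (simp add: infsum_reindex[OF inj] o_def)
  also have "\<dots> = cinner f (lower i [j] g)"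
    unfolding cinner_l2_def by (simp add: creation.rep_eq lower.rep_eq \<phi>_def)
  finally show ?thesis .
qed

lemma lower_creation: "lower i [j] (creation i j f) = f"
  by (rule l2_eqI) (simp add: lower.rep_eq creation.rep_eq)

lemma norm_creation: "norm (creation i j f) = norm f"
proof -
  have "(complex_of_real ((norm (creation i j f))\<^sup>2)) = of_real ((norm f)\<^sup>2)"
    unfolding cinner_self[symmetric] by (simp add: cinner_creation lower_creation)
  then show ?thesis unfolding of_real_eq_iff by simp
qed

lemma lower_Nil: "lower i [] f = f"
  by (rule l2_eqI) (simp add: lower.rep_eq)

text \<open>The first letter is stripped first, in accordance with the reversed order of factors in
  the adjoint of \<open>word_op\<close>.\<close>

lemma lower_Cons: "lower i (j # \<alpha>) f = lower i \<alpha> (lower i [j] f)"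
  by (rule l2_eqI) (simp add: lower.rep_eq)

lemma word_op_Nil: "word_op X [] x = x"
  by (simp add: word_op_def)

lemma word_op_Cons: "word_op X (j # \<alpha>) x = X j (word_op X \<alpha> x)"
  by (simp add: word_op_def)

lemma cinner_word_op_creation: "cinner (word_op (creation i) \<alpha> f) g = cinner f (lower i \<alpha> g)"
proof (induction \<alpha> arbitrary: g)
  case Nil
  show ?case by (simp add: lower_Nil word_op_Nil)
next
  case (Cons j \<alpha>)
  show ?case unfolding word_op_Cons cinner_creation Cons.IH lower_Cons[of i j \<alpha> g] ..
qed

lemma word_op_creation_fock:
  assumes "csubspace E" "i \<in> {1..k}" "set \<alpha> \<subseteq> {1..n i}" "f \<in> fock k n E"
  shows "word_op (creation i) \<alpha> f \<in> fock k n E"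
  using assms(3) by (induction \<alpha>) (use assms in \<open>auto simp: word_op_Nil word_op_Cons intro!: creation_fock\<close>)

lemma coord_foldr_lower:
  "distinct xs \<Longrightarrow> coord (foldr (\<lambda>i. lower i (\<beta> i)) xs f) \<gamma> = coord f (\<lambda>i. if i \<in> set xs then \<beta> i @ \<gamma> i else \<gamma> i)"
proof (induction xs arbitrary: \<gamma>)
  case (Cons i xs)
  have "(\<lambda>l. if l \<in> set xs then \<beta> l @ (\<gamma>(i := \<beta> i @ \<gamma> i)) l else (\<gamma>(i := \<beta> i @ \<gamma> i)) l)
      = (\<lambda>l. if l \<in> set (i # xs) then \<beta> l @ \<gamma> l else \<gamma> l)"
    using Cons.prems by (auto simp: fun_eq_iff)
  then show ?case using Cons by (simp add: lower.rep_eq)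
qed simp

text \<open>Lowering along \<beta> moves the coefficient at \<beta> to the vacuum index. In this way
  the Berezin kernel, whose square-root factor sees only the vacuum, recovers every
  coefficient.\<close>

lemma coord_foldr_lower_empty_word:
  assumes "\<beta> \<in> multiwords k n"
  shows "coord (foldr (\<lambda>i. lower i (\<beta> i)) [1..<Suc k] f) (empty_word k) = coord f \<beta>"
proof -
  have "(\<lambda>i. if i \<in> set [1..<Suc k] then \<beta> i @ empty_word k i else empty_word k i) = \<beta>"
    using assms by (auto simp: fun_eq_iff empty_word_def multiwords_iff)
  then show ?thesis by (simp add: coord_foldr_lower del: upt_Suc)
qed

lemma vacuum_proj_empty: "vacuum_proj {} f = f"
  by (rule l2_eqI) (simp add: vacuum_proj.rep_eq)

text \<open>Lowering and re-creating a first letter, summed over all letters, keeps exactly the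
  components whose \<open>i\<close>-th word is nonempty. This is one factor
  \<open>id - \<Phi>\<close> of the defect.\<close>

lemma vacuum_proj_insert:
  assumes "i \<notin> I" "i \<in> {1..k}" "f \<in> fock k n E"
  shows "vacuum_proj (insert i I) f
    = vacuum_proj I f - (\<Sum>j=1..n i. creation i j (vacuum_proj I (lower i [j] f)))"
proof (rule l2_eqI)
  fix \<gamma> :: multiword
  define b where "b = (\<forall>l\<in>I. \<gamma> l = [])"
  have b: "(\<forall>l\<in>I. (\<gamma>(i := \<delta>)) l = []) \<longleftrightarrow> b" for \<delta>
    unfolding b_def using assms(1) by (metis fun_upd_other)
  have t: "coord (creation i j (vacuum_proj I (lower i [j] f))) \<gamma>
      = (if \<gamma> i \<noteq> [] \<and> hd (\<gamma> i) = j \<and> b then coord f \<gamma> else 0)" for j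
  proof -
    have "\<gamma>(i := j # tl (\<gamma> i)) = \<gamma>" if "\<gamma> i \<noteq> []" "hd (\<gamma> i) = j"
      using that by (auto simp: fun_eq_iff)
    then show ?thesis
      unfolding creation.rep_eq vacuum_proj.rep_eq b by (auto simp: lower.rep_eq)
  qed
  show "coord (vacuum_proj (insert i I) f) \<gamma>
    = coord (vacuum_proj I f - (\<Sum>j=1..n i. creation i j (vacuum_proj I (lower i [j] f)))) \<gamma>"
  proof (cases "\<gamma> i = [] \<or> \<not> b")
    case True
    then have "coord (creation i j (vacuum_proj I (lower i [j] f))) \<gamma> = 0" for j
      unfolding t by auto
    then show ?thesis
      using True unfolding coord_diff coord_sum by (auto simp: vacuum_proj.rep_eq b_def)
  next
    case False
    then have s: "(\<Sum>j=1..n i. coord (creation i j (vacuum_proj I (lower i [j] f))) \<gamma>)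
        = (if hd (\<gamma> i) \<in> {1..n i} then coord f \<gamma> else 0)"
      unfolding t by (simp add: sum.delta)
    \<comment> \<open>A first letter outside \<open>{1..n i}\<close> is missed by the sum over
      \<open>j\<close>; there the coefficient vanishes because \<open>f\<close> lies in the Fock
      space.\<close>
    have "coord f \<gamma> = 0" if "hd (\<gamma> i) \<notin> {1..n i}"
    proof -
      have "\<gamma> \<notin> multiwords k n"
        using that False assms(2) set_multiword[of \<gamma> k n i] hd_in_set[of "\<gamma> i"] by blast
      then show ?thesis using assms(3) by (auto simp: fock_def)
    qed
    then show ?thesis
      using False unfolding coord_diff coord_sum s by (auto simp: vacuum_proj.rep_eq b_def)
  qed
qed

lemma vacuum_proj_full:
  assumes "f \<in> fock k n E"
  shows "vacuum_proj {1..k} f = basis_tensor (empty_word k) (coord f (empty_word k))"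
proof (rule l2_eqI)
  fix \<gamma> :: multiword
  have "\<gamma> = empty_word k" if "\<forall>i\<in>{1..k}. \<gamma> i = []" "\<gamma> \<in> multiwords k n"
    using that by (auto simp: fun_eq_iff empty_word_def multiwords_iff)
  moreover have "\<forall>i\<in>{1..k}. empty_word k i = []" by (simp add: empty_word_def)
  moreover have "coord f \<gamma> = 0" if "\<gamma> \<notin> multiwords k n" using assms that by (simp add: fock_def)
  ultimately show "coord (vacuum_proj {1..k} f) \<gamma> = coord (basis_tensor (empty_word k) (coord f (empty_word k))) \<gamma>"
    unfolding vacuum_proj.rep_eq basis_tensor.rep_eq by metis
qed

text \<open>The vacuum projection is a polynomial in the creation and lowering operators.\<close>

lemma basis_tensor_empty_word_mem:
  assumes L: "csubspace L" "L \<subseteq> fock k n E"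
    and cr: "\<And>i j f. i \<in> {1..k} \<Longrightarrow> j \<in> {1..n i} \<Longrightarrow> f \<in> L \<Longrightarrow> creation i j f \<in> L"
    and lo: "\<And>i j f. i \<in> {1..k} \<Longrightarrow> j \<in> {1..n i} \<Longrightarrow> f \<in> L \<Longrightarrow> lower i [j] f \<in> L"
    and f: "f \<in> L" and \<beta>: "\<beta> \<in> multiwords k n"
  shows "basis_tensor (empty_word k) (coord f \<beta>) \<in> L"
proof -
  have low: "lower i \<alpha> g \<in> L" if "g \<in> L" "i \<in> {1..k}" "set \<alpha> \<subseteq> {1..n i}" for i \<alpha> g
    using that
  proof (induction \<alpha> arbitrary: g)
    case Nil
    then show ?case by (simp add: lower_Nil)
  next
    case (Cons j \<alpha>)
    then have "lower i \<alpha> (lower i [j] g) \<in> L" using lo by simp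
    then show ?case unfolding lower_Cons[of i j \<alpha> g] .
  qed
  have lows: "foldr (\<lambda>i. lower i (\<beta> i)) xs g \<in> L" if "g \<in> L" "set xs \<subseteq> {1..k}" for xs g
    using that(2)
  proof (induction xs)
    case (Cons i xs)
    have "set (\<beta> i) \<subseteq> {1..n i}"
      using set_multiword[OF \<beta>] Cons.prems by simp
    then show ?case using Cons by (simp add: low)
  qed (use that in simp)
  have vac: "vacuum_proj I g \<in> L" if "finite I" "I \<subseteq> {1..k}" "g \<in> L" for I g
    using that
  proof (induction I arbitrary: g rule: finite_induct)
    case empty
    then show ?case by (simp add: vacuum_proj_empty)
  next
    case (insert i I)
    have i: "i \<in> {1..k}" using insert.prems by auto
    have gE: "g \<in> fock k n E" using insert.prems L(2) by blast
    show ?case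
      unfolding vacuum_proj_insert[OF insert.hyps(2) i gE]
      using insert.prems
      by (intro complex_vector.subspace_diff complex_vector.subspace_sum L(1) cr[OF i] insert.IH lo[OF i]) auto
  qed
  \<comment> \<open>Shift the coefficient at \<beta> to the vacuum index, then isolate it by the
    vacuum projection; both operations stay in \<open>L\<close>.\<close>
  define g where "g = foldr (\<lambda>i. lower i (\<beta> i)) [1..<Suc k] f"
  have "set [1..<Suc k] \<subseteq> {1..k}" by auto
  then have g: "g \<in> L" unfolding g_def using lows f by blast
  have "vacuum_proj {1..k} g = basis_tensor (empty_word k) (coord f \<beta>)"
    using vacuum_proj_full[of g k n E] g L(2) coord_foldr_lower_empty_word[OF \<beta>, of f]
    by (auto simp: g_def)
  then show ?thesis using vac[OF _ _ g, of "{1..k}"] by simp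
qed

lemma cinner_basis_tensor_right: "cinner f (basis_tensor \<beta> e) = cinner (coord f \<beta>) e"
proof -
  have "cinner f (basis_tensor \<beta> e) = (\<Sum>\<^sub>\<infinity>x\<in>{\<beta>}. cinner (coord f x) (coord (basis_tensor \<beta> e) x))"
    unfolding cinner_l2_def by (rule infsum_cong_neutral) (auto simp: basis_tensor.rep_eq)
  then show ?thesis by (simp add: basis_tensor.rep_eq)
qed

lemma basis_tensor_add: "basis_tensor \<beta> (x + y) = basis_tensor \<beta> x + basis_tensor \<beta> y"
  by (rule l2_eqI) (simp add: basis_tensor.rep_eq plus_l2.rep_eq)

lemma basis_tensor_scaleC: "basis_tensor \<beta> (c *\<^sub>C x) = c *\<^sub>C basis_tensor \<beta> x"
  by (rule l2_eqI) (simp add: basis_tensor.rep_eq coord_scaleC)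

lemma basis_tensor_sum: "basis_tensor \<beta> (\<Sum>i\<in>I. f i) = (\<Sum>i\<in>I. basis_tensor \<beta> (f i))"
  by (rule l2_eqI) (simp add: basis_tensor.rep_eq coord_sum)

lemma basis_tensor_zero: "basis_tensor \<beta> 0 = 0"
  by (rule l2_eqI) (simp add: basis_tensor.rep_eq zero_l2.rep_eq)

lemma closed_fock:
  assumes "csubspace E" "closed E"
  shows "closed (fock k n E)"
proof -
  have bl: "bounded_linear (\<lambda>f :: (multiword, 'a) l2. coord f \<beta>)" for \<beta>
    by (rule bounded_linear_intro[where K = 1]) (simp_all add: plus_l2.rep_eq coord_scaleR_l2 norm_coord_le)
  have "closed ((\<lambda>f. coord f \<beta>) -` (if \<beta> \<in> multiwords k n then E else {0}))" for \<beta>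
    using assms by (intro closed_vimage linear_continuous_on[OF bl]) auto
  then have "closed (\<Inter>\<beta>. (\<lambda>f. coord f \<beta>) -` (if \<beta> \<in> multiwords k n then E else {0}))"
    by blast
  also have "(\<Inter>\<beta>. (\<lambda>f. coord f \<beta>) -` (if \<beta> \<in> multiwords k n then E else {0})) = fock k n E"
    by (auto simp: fock_def split: if_splits)
  finally show ?thesis .
qed

section \<open>Curvature\<close>

lemma has_sum_sum:
  fixes f :: "'i \<Rightarrow> 'a \<Rightarrow> 'b::topological_comm_monoid_add"
  assumes "\<And>i. i \<in> I \<Longrightarrow> (f i has_sum s i) A"
  shows "((\<lambda>x. \<Sum>i\<in>I. f i x) has_sum (\<Sum>i\<in>I. s i)) A"
  using assms by (induction I rule: infinite_finite_induct) (auto intro: has_sum_add)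

section \<open>Adjoints and the square root of a projection\<close>

lemma adj_eqI:
  assumes "csubspace G" "x \<in> G" "\<And>z. z \<in> G \<Longrightarrow> cinner (A z) y = cinner z x"
  shows "adj G A y = x"
  unfolding adj_def
proof (rule the_equality)
  fix x' assume "x' \<in> G \<and> (\<forall>z\<in>G. cinner (A z) y = cinner z x')"
  then show "x' = x" using assms by (intro eq_if_cinner_eq[OF assms(1)]) auto
qed (use assms in blast)

text \<open>\<open>B\<close> vanishes on the kernel of \<open>P\<close> since a positive \<open>B\<close> with \<open>B (B x) = 0\<close> kills \<open>x\<close> (vary \<open>t\<close> in
  the positivity of \<open>B\<close> at \<open>x + t B x\<close>), and it fixes the range of \<open>P\<close> since \<open>B y = - y\<close> forces \<open>y = 0\<close>.\<close>

lemma positive_root_of_projection: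
  assumes G: "csubspace G" and P: "P ` G \<subseteq> G" "\<And>x. x \<in> G \<Longrightarrow> P (P x) = P x"
    and B: "positive_op G B" "\<And>x. x \<in> G \<Longrightarrow> B (B x) = P x" and x: "x \<in> G"
  shows "B x = P x"
proof -
  have mem: "B y \<in> G" if "y \<in> G" for y
    using B(1) that by (auto simp: positive_op_def bounded_op_def)
  have add: "B (y + z) = B y + B z" if "y \<in> G" "z \<in> G" for y z
    using B(1) that by (auto simp: positive_op_def bounded_op_def)
  have scale: "B (c *\<^sub>C y) = c *\<^sub>C B y" if "y \<in> G" for c y
    using B(1) that by (auto simp: positive_op_def bounded_op_def)
  have pos: "0 \<le> Re (cinner (B y) y)" if "y \<in> G" for y
    using B(1) that by (auto simp: positive_op_def)
  have diff: "B (y - z) = B y - B z" if "y \<in> G" "z \<in> G" for y z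
    using add[of "y - z" z] that complex_vector.subspace_diff[OF G] by simp
  have zero: "B y = 0" if y: "y \<in> G" "B (B y) = 0" for y
  proof (rule ccontr)
    assume "B y \<noteq> 0"
    then have n: "0 < (norm (B y))\<^sup>2" by simp
    \<comment> \<open>Chosen so that the quadratic form below takes the value -1.\<close>
    define t where "t = - (Re (cinner (B y) y) + 1) / (norm (B y))\<^sup>2"
    have t: "complex_of_real t *\<^sub>C B y \<in> G"
      using complex_vector.subspace_scale[OF G mem[OF y(1)]] .
    have "B (y + complex_of_real t *\<^sub>C B y) = B y"
      using add[OF y(1) t] scale[OF mem[OF y(1)], of t] y(2) by simp
    then have "0 \<le> Re (cinner (B y) (y + complex_of_real t *\<^sub>C B y))"
      using pos[of "y + complex_of_real t *\<^sub>C B y"] complex_vector.subspace_add[OF G y(1) t] by simp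
    also have "\<dots> = Re (cinner (B y) y) + t * (norm (B y))\<^sup>2"
      by (simp add: cinner_add_right cinner_scaleC_right cinner_self flip: of_real_power)
    also have "\<dots> = - 1" using n by (simp add: t_def)
    finally show False by simp
  qed
  have Px: "P x \<in> G" using P(1) x by blast
  have "B (B (x - P x)) = P x - P (P x)"
    using x Px by (simp add: diff mem B(2))
  then have "B (x - P x) = 0"
    using zero[OF complex_vector.subspace_diff[OF G x Px]] P(2)[OF x] by simp
  then have BP: "B x = B (P x)" using diff[OF x Px] by simp
  define y where "y = B (P x) - P x"
  have y: "y \<in> G" unfolding y_def by (intro complex_vector.subspace_diff[OF G] mem Px)
  have "B (B (P x)) = P x" using B(2)[OF Px] P(2)[OF x] by simp
  then have "B y = (- 1) *\<^sub>C y"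
    using diff[OF mem[OF Px] Px] complex_vector.scale_minus_left[of 1 y] by (simp add: y_def scaleC_one)
  then have "0 \<le> Re (- 1 * cinner y y)" using pos[OF y] by (simp only: cinner_scaleC_left)
  then have "(norm y)\<^sup>2 \<le> 0"
    by (simp add: cinner_self flip: of_real_power)
  then show ?thesis using BP by (simp add: y_def)
qed

text \<open>\<open>P\<close> is its own positive root, so the choice in \<open>sqrt_op\<close> has a
  witness; uniqueness then identifies whichever root was chosen.\<close>

lemma sqrt_op_projection:
  assumes "csubspace G" "positive_op G P" "\<And>x. x \<in> G \<Longrightarrow> P (P x) = P x" "x \<in> G"
  shows "sqrt_op G P x = P x"
proof -
  have "positive_op G (sqrt_op G P) \<and> (\<forall>x\<in>G. sqrt_op G P (sqrt_op G P x) = P x)"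
    unfolding sqrt_op_def by (rule someI[of _ P]) (use assms in simp)
  moreover have "P ` G \<subseteq> G" using assms(2) by (simp add: positive_op_def bounded_op_def)
  ultimately show ?thesis using positive_root_of_projection[OF assms(1) _ assms(3) _ _ assms(4)] by blast
qed

text \<open>The operator I tensor \<open>J\<close>. Square-summability of the new family is not
  built in; it follows when \<open>J\<close> preserves norms on \<open>E\<close>, as
  \<open>coord_lift_map\<close> assumes.\<close>

definition lift_map ::
    "nat \<Rightarrow> (nat \<Rightarrow> nat) \<Rightarrow> ('e::complex_inner \<Rightarrow> 'f::complex_inner) \<Rightarrow> (multiword, 'e) l2 \<Rightarrow> (multiword, 'f) l2" where
  "lift_map k n J f = Abs_l2 (\<lambda>\<beta>. if \<beta> \<in> multiwords k n then J (coord f \<beta>) else 0)"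

text \<open>Indexes the standard basis of the range of the length projection, so its cardinality is
  the trace in the denominator of the curvature.\<close>

definition words_of_length :: "nat \<Rightarrow> (nat \<Rightarrow> nat) \<Rightarrow> (nat \<Rightarrow> nat) \<Rightarrow> multiword set" where
  "words_of_length k n q = {\<beta>\<in>multiwords k n. \<forall>i\<in>{1..k}. length (\<beta> i) = q i}"

lemma finite_words_of_length: "finite (words_of_length k n q)"
proof (rule finite_subset)
  show "words_of_length k n q \<subseteq> (\<Pi>\<^sub>E i\<in>{1..k}. {xs. set xs \<subseteq> {1..n i} \<and> length xs = q i})"
    by (auto simp: words_of_length_def multiwords_iff PiE_iff extensional_def)
  show "finite (\<Pi>\<^sub>E i\<in>{1..k}. {xs. set xs \<subseteq> {1..n i} \<and> length xs = q i})"
    by (intro finite_PiE finite_lists_length_eq) simp_all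
qed

text \<open>Keeps the denominators of the curvature nonzero: with at least one letter per alphabet,
  words of every length exist.\<close>

lemma words_of_length_nonempty:
  assumes "\<forall>i\<in>{1..k}. 1 \<le> n i"
  shows "words_of_length k n q \<noteq> {}"
proof -
  have "(\<lambda>i\<in>{1..k}. replicate (q i) 1) \<in> words_of_length k n q"
    using assms by (auto simp: words_of_length_def multiwords_iff)
  then show ?thesis by blast
qed

lemma norm_eq_if_cinner_eq:
  assumes "\<And>x y. x \<in> E \<Longrightarrow> y \<in> E \<Longrightarrow> cinner (J x) (J y) = cinner x y" "x \<in> E"
  shows "norm (J x) = norm x"
proof -
  have "complex_of_real ((norm (J x))\<^sup>2) = of_real ((norm x)\<^sup>2)"
    using assms(1)[OF assms(2,2)] unfolding cinner_self .
  then show ?thesis unfolding of_real_eq_iff by simp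
qed

lemma coord_lift_map:
  assumes "f \<in> fock k n E" "\<And>x. x \<in> E \<Longrightarrow> norm (J x) = norm x"
  shows "coord (lift_map k n J f) \<beta> = (if \<beta> \<in> multiwords k n then J (coord f \<beta>) else 0)"
proof -
  have "(norm (if \<beta> \<in> multiwords k n then J (coord f \<beta>) else 0))\<^sup>2 = (norm (coord f \<beta>))\<^sup>2" for \<beta>
    using assms by (auto simp: fock_def)
  then have "(\<lambda>\<beta>. (norm (if \<beta> \<in> multiwords k n then J (coord f \<beta>) else 0))\<^sup>2) summable_on UNIV"
    by (simp only: l2_summable)
  then show ?thesis unfolding lift_map_def by (subst Abs_l2_inverse) auto
qed

lemma cinner_lift_map:
  assumes "f \<in> fock k n E" "g \<in> fock k n E"
    and J: "\<And>x y. x \<in> E \<Longrightarrow> y \<in> E \<Longrightarrow> cinner (J x) (J y) = cinner x y"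
  shows "cinner (lift_map k n J f) (lift_map k n J g) = cinner f g"
proof -
  have J': "norm (J x) = norm x" if "x \<in> E" for x
    by (rule norm_eq_if_cinner_eq[of E J, OF _ that]) (rule J)
  show ?thesis
    unfolding cinner_l2_def
    using assms by (intro infsum_cong)
      (auto simp: coord_lift_map[OF assms(1) J'] coord_lift_map[OF assms(2) J'] fock_def)
qed

lemma length_proj_fock:
  "csubspace E \<Longrightarrow> f \<in> fock k n E \<Longrightarrow> length_proj k q f \<in> fock k n E"
  using complex_vector.subspace_0 by (auto simp: fock_def length_proj.rep_eq)

lemma vacuum_proj_fock:
  "csubspace E \<Longrightarrow> f \<in> fock k n E \<Longrightarrow> vacuum_proj I f \<in> fock k n E"
  using complex_vector.subspace_0 by (auto simp: fock_def vacuum_proj.rep_eq)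

lemma length_proj_lift_map:
  assumes E: "csubspace E" and f: "f \<in> fock k n E" and J: "\<And>x. x \<in> E \<Longrightarrow> norm (J x) = norm x"
  shows "length_proj k q (lift_map k n J f) = lift_map k n J (length_proj k q f)"
proof -
  have "J 0 = 0" using J[of 0] complex_vector.subspace_0[OF E] by simp
  then show ?thesis
    by (intro l2_eqI)
       (simp add: length_proj.rep_eq coord_lift_map[OF f J] coord_lift_map[OF length_proj_fock[OF E f] J])
qed

text \<open>Expresses that the creation operators on \<open>G\<close> are a unitary copy of those on
  \<open>fock k n E\<close>. \<open>E\<close> is merely a subspace here; arguments with limits add
  closedness, which a finite orthonormal basis of \<open>E\<close> supplies.\<close>

locale fock_model =
  fixes k :: nat and n :: "nat \<Rightarrow> nat" and E :: "'e::chilbert_space set"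
    and V :: "(multiword, 'e) l2 \<Rightarrow> (multiword, 'h::chilbert_space) l2" and G :: "(multiword, 'h) l2 set"
  assumes csubspace_E: "csubspace E"
    and unitary_V: "unitary_op (fock k n E) G V"
    and intertwines: "\<And>i j f. i \<in> {1..k} \<Longrightarrow> j \<in> {1..n i} \<Longrightarrow> f \<in> fock k n E
      \<Longrightarrow> V (creation i j f) = creation i j (V f)"
begin

abbreviation "F \<equiv> fock k n E"

lemma csubspace_F: "csubspace F"
  by (rule csubspace_fock[OF csubspace_E])

lemma V_mem: "f \<in> F \<Longrightarrow> V f \<in> G"
  and V_add: "f \<in> F \<Longrightarrow> g \<in> F \<Longrightarrow> V (f + g) = V f + V g"
  and V_scaleC: "f \<in> F \<Longrightarrow> V (c *\<^sub>C f) = c *\<^sub>C V f"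
  and cinner_V: "f \<in> F \<Longrightarrow> g \<in> F \<Longrightarrow> cinner (V f) (V g) = cinner f g"
  and image_V: "V ` F = G"
  using unitary_V by (auto simp: unitary_op_def bounded_op_def)

lemma V_cases: assumes "x \<in> G" obtains f where "f \<in> F" "x = V f"
  using assms image_V by blast

lemma V_zero: "V 0 = 0"
  using V_add[of 0 0] complex_vector.subspace_0[OF csubspace_F] by simp

lemma V_diff: "f \<in> F \<Longrightarrow> g \<in> F \<Longrightarrow> V (f - g) = V f - V g"
  using V_add[of "f - g" g] complex_vector.subspace_diff[OF csubspace_F] by simp

lemma V_sum: "(\<And>i. i \<in> I \<Longrightarrow> f i \<in> F) \<Longrightarrow> V (\<Sum>i\<in>I. f i) = (\<Sum>i\<in>I. V (f i))"
  by (induction I rule: infinite_finite_induct)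
     (auto simp: V_zero V_add complex_vector.subspace_sum[OF csubspace_F])

lemma norm_V: "f \<in> F \<Longrightarrow> norm (V f) = norm f"
  by (rule norm_eq_if_cinner_eq[of F V]) (rule cinner_V)

lemma csubspace_G: "csubspace G"
  unfolding complex_vector.subspace_def
proof (intro conjI ballI allI)
  show "0 \<in> G" using V_mem[of 0] V_zero complex_vector.subspace_0[OF csubspace_F] by simp
  show "x + y \<in> G" if "x \<in> G" "y \<in> G" for x y
    using that by (elim V_cases) (simp flip: V_add add: V_mem complex_vector.subspace_add[OF csubspace_F])
  show "c *\<^sub>C x \<in> G" if "x \<in> G" for c x
    using that by (elim V_cases) (simp flip: V_scaleC add: V_mem complex_vector.subspace_scale[OF csubspace_F])
qed

text \<open>\<open>V\<close> is isometric, so the preimages of a convergent sequence are Cauchy, and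
  their limit stays in the closed space \<open>F\<close>.\<close>

lemma closed_G:
  assumes "closed E"
  shows "closed G"
  unfolding closed_sequential_limits
proof (intro allI impI, elim conjE)
  fix x l assume x: "\<forall>m. x m \<in> G" and l: "x \<longlonglongrightarrow> l"
  obtain f where f: "\<And>m. f m \<in> F" "\<And>m. x m = V (f m)" 
  proof -
    have "\<forall>m. \<exists>f. f \<in> F \<and> x m = V f" using x image_V by blast
    then show ?thesis using that by metis
  qed
  have d: "dist (V g) (V h) = dist g h" if "g \<in> F" "h \<in> F" for g h
    using that norm_V[OF complex_vector.subspace_diff[OF csubspace_F that]] by (simp add: dist_norm V_diff)
  have "Cauchy x" using l by (rule LIMSEQ_imp_Cauchy)
  then have "Cauchy f" unfolding Cauchy_def by (simp add: f d)
  then obtain g where g: "f \<longlonglongrightarrow> g" by (auto simp: Cauchy_convergent_iff convergent_def)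
  have gF: "g \<in> F" by (rule closed_sequentially[OF closed_fock[OF csubspace_E assms] f(1) g])
  have "(\<lambda>m. dist (f m) g) \<longlonglongrightarrow> 0" using g by (rule iffD1[OF tendsto_dist_iff])
  then have "(\<lambda>m. dist (x m) (V g)) \<longlonglongrightarrow> 0" by (simp add: f d gF)
  then have "x \<longlonglongrightarrow> V g" by (rule iffD2[OF tendsto_dist_iff])
  then have "l = V g" using l LIMSEQ_unique by blast
  then show "l \<in> G" using V_mem gF by simp
qed

lemma intertwines_word_op:
  assumes "i \<in> {1..k}" "set \<alpha> \<subseteq> {1..n i}" "f \<in> F"
  shows "word_op (creation i) \<alpha> (V f) = V (word_op (creation i) \<alpha> f)"
  using assms(2)
  by (induction \<alpha>) (use assms in \<open>auto simp: word_op_Nil word_op_Cons intertwines word_op_creation_fock[OF csubspace_E]\<close>)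

text \<open>\<open>adj G\<close> is the adjoint of the restriction to \<open>G\<close>. Since
  lowering leaves \<open>F\<close> invariant, it corresponds to plain lowering under
  \<open>V\<close>.\<close>

lemma adj_word_op:
  assumes "i \<in> {1..k}" "set \<alpha> \<subseteq> {1..n i}" "f \<in> F"
  shows "adj G (word_op (creation i) \<alpha>) (V f) = V (lower i \<alpha> f)"
proof (rule adj_eqI[OF csubspace_G])
  show "V (lower i \<alpha> f) \<in> G" by (intro V_mem lower_fock assms)
  fix z assume "z \<in> G"
  then obtain g where g: "g \<in> F" "z = V g" by (rule V_cases)
  then show "cinner (word_op (creation i) \<alpha> z) (V f) = cinner z (V (lower i \<alpha> f))"
    using assms by (simp add: intertwines_word_op cinner_V word_op_creation_fock[OF csubspace_E]
        lower_fock cinner_word_op_creation)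
qed

lemma adj_creation:
  assumes "i \<in> {1..k}" "j \<in> {1..n i}" "f \<in> F"
  shows "adj G (creation i j) (V f) = V (lower i [j] f)"
  using adj_word_op[of i "[j]" f] assms by (simp add: word_op_def)

text \<open>Induction over the tensor factors: under \<open>V\<close> each factor of the defect
  becomes the identity \<open>vacuum_proj_insert\<close>. Arbitrary lists of distinct indices are
  needed to peel off the \<open>foldr\<close>.\<close>

lemma partial_defect:
  assumes "distinct xs" "set xs \<subseteq> {1..k}" "f \<in> F"
  shows "foldr (\<lambda>i Y x. Y x - cp_map G (n i) (creation i) Y x) xs id (V f) = V (vacuum_proj (set xs) f)"
  using assms
proof (induction xs arbitrary: f)
  case Nil
  then show ?case by (simp add: vacuum_proj_empty)
next
  case (Cons i xs)
  have i: "i \<in> {1..k}" "i \<notin> set xs" and d: "distinct xs" "set xs \<subseteq> {1..k}" using Cons.prems by auto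
  define Y where "Y = foldr (\<lambda>i Y x. Y x - cp_map G (n i) (creation i) Y x) xs id"
  have Y: "Y (V g) = V (vacuum_proj (set xs) g)" if "g \<in> F" for g
    unfolding Y_def by (rule Cons.IH[OF d that])
  have lF: "lower i [j] f \<in> F" if "j \<in> {1..n i}" for j
    using that Cons.prems(3) i by (intro lower_fock) auto
  have "cp_map G (n i) (creation i) Y (V f) = (\<Sum>j=1..n i. creation i j (V (vacuum_proj (set xs) (lower i [j] f))))"
    unfolding cp_map_def by (intro sum.cong refl) (simp add: adj_creation[OF i(1) _ Cons.prems(3)] Y lF)
  also have "\<dots> = (\<Sum>j=1..n i. V (creation i j (vacuum_proj (set xs) (lower i [j] f))))"
    by (intro sum.cong refl) (simp add: intertwines[OF i(1)] vacuum_proj_fock[OF csubspace_E] lF)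
  also have "\<dots> = V (\<Sum>j=1..n i. creation i j (vacuum_proj (set xs) (lower i [j] f)))"
    by (intro V_sum[symmetric] creation_fock csubspace_E i(1) vacuum_proj_fock lF)
  finally have "Y (V f) - cp_map G (n i) (creation i) Y (V f)
      = V (vacuum_proj (set xs) f - (\<Sum>j=1..n i. creation i j (vacuum_proj (set xs) (lower i [j] f))))"
    using Cons.prems(3)
    by (subst V_diff)
       (auto simp: Y intro!: complex_vector.subspace_sum[OF csubspace_F] creation_fock csubspace_E i(1) vacuum_proj_fock lF)
  also have "\<dots> = V (vacuum_proj (set (i # xs)) f)"
    using vacuum_proj_insert[OF i(2,1) Cons.prems(3)] by simp
  finally show ?case by (simp only: Y_def foldr_Cons comp_def)
qed

text \<open>Embeds the coefficient space isometrically into \<open>G\<close> as the image of the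
  vacuum vectors; by \<open>defect_V\<close> this image is the range of the defect.\<close>

abbreviation "J e \<equiv> V (basis_tensor (empty_word k) e)"

lemma vacuum_mem: "e \<in> E \<Longrightarrow> basis_tensor (empty_word k) e \<in> F"
  by (rule basis_tensor_fock[OF csubspace_E]) simp_all

lemma coord_mem: "f \<in> F \<Longrightarrow> coord f \<beta> \<in> E"
  using complex_vector.subspace_0[OF csubspace_E] by (cases "\<beta> \<in> multiwords k n") (auto simp: fock_def)

lemma cinner_J: "e \<in> E \<Longrightarrow> e' \<in> E \<Longrightarrow> cinner (J e) (J e') = cinner e e'"
  by (simp add: cinner_V vacuum_mem cinner_basis_tensor)

lemma norm_J: "e \<in> E \<Longrightarrow> norm (J e) = norm e"
  by (rule norm_eq_if_cinner_eq[of E J]) (rule cinner_J)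

lemma coord_lift_J:
  "f \<in> F \<Longrightarrow> coord (lift_map k n J f) \<beta> = (if \<beta> \<in> multiwords k n then J (coord f \<beta>) else 0)"
  by (rule coord_lift_map[where E = E]) (simp_all add: norm_J)

lemma cinner_lift_J: "f \<in> F \<Longrightarrow> g \<in> F \<Longrightarrow> cinner (lift_map k n J f) (lift_map k n J g) = cinner f g"
  by (rule cinner_lift_map[where E = E]) (simp_all add: cinner_J)

lemma length_proj_lift_J: "f \<in> F \<Longrightarrow> length_proj k q (lift_map k n J f) = lift_map k n J (length_proj k q f)"
  by (rule length_proj_lift_map[OF csubspace_E]) (simp_all add: norm_J)

lemma defect_V:
  assumes "f \<in> F"
  shows "defect k n G creation (V f) = J (coord f (empty_word k))"
proof -
  have "set [1..<Suc k] = {1..k}" by auto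
  then show ?thesis
    using partial_defect[of "[1..<Suc k]" f] assms vacuum_proj_full[OF assms]
    by (simp add: defect_def del: upt_Suc)
qed

lemma defect_idem:
  assumes "x \<in> G"
  shows "defect k n G creation (defect k n G creation x) = defect k n G creation x"
  using assms by (elim V_cases) (simp add: defect_V vacuum_mem coord_mem basis_tensor.rep_eq)

lemma positive_defect: "positive_op G (defect k n G creation)"
proof -
  let ?D = "defect k n G creation"
  have mem: "?D x \<in> G" if "x \<in> G" for x
    using that by (elim V_cases) (simp add: defect_V V_mem vacuum_mem coord_mem)
  have add: "?D (x + y) = ?D x + ?D y" if "x \<in> G" "y \<in> G" for x y
    using that by (elim V_cases)
      (simp flip: V_add add: defect_V vacuum_mem coord_mem complex_vector.subspace_add[OF csubspace_F]
        basis_tensor_add[symmetric] plus_l2.rep_eq)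
  have scale: "?D (c *\<^sub>C x) = c *\<^sub>C ?D x" if "x \<in> G" for c x
    using that by (elim V_cases)
      (simp flip: V_scaleC add: defect_V vacuum_mem coord_mem complex_vector.subspace_scale[OF csubspace_F]
        basis_tensor_scaleC[symmetric] coord_scaleC)
  have bd: "norm (?D x) \<le> 1 * norm x" if "x \<in> G" for x
    using that by (elim V_cases) (simp add: defect_V norm_J coord_mem norm_V norm_coord_le)
  have "cinner (?D x) x = of_real ((norm (?D x))\<^sup>2)" if x: "x \<in> G" for x
  proof -
    obtain f where f: "f \<in> F" "x = V f" using x by (rule V_cases)
    have "cinner (?D x) x = cnj (cinner x (?D x))" by (rule cinner_commute)
    also have "cinner x (?D x) = cinner (coord f (empty_word k)) (coord f (empty_word k))"
      using f by (simp add: defect_V cinner_V vacuum_mem coord_mem cinner_basis_tensor_right)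
    finally show ?thesis using f by (simp add: defect_V norm_J coord_mem cinner_self)
  qed
  then have "cinner (?D x) x \<in> \<real> \<and> 0 \<le> Re (cinner (?D x) x)" if "x \<in> G" for x
    using that by simp
  then show ?thesis
    unfolding positive_op_def bounded_op_def using mem add scale bd by blast
qed

lemma sqrt_defect_V: "f \<in> F \<Longrightarrow> sqrt_op G (defect k n G creation) (V f) = J (coord f (empty_word k))"
  using sqrt_op_projection[OF csubspace_G positive_defect defect_idem V_mem] defect_V by simp

text \<open>In the summand at \<beta> the adjoints lower \<open>f\<close> along \<beta>, and the
  square root, which is the defect itself, reads the vacuum coefficient of the result, that is
  \<open>coord f \<beta>\<close>. Off the multiwords \<open>lift_map\<close> vanishes, so the
  expansion over all indices applies.\<close>

lemma berezin_kernel_V: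
  assumes f: "f \<in> F"
  shows "berezin_kernel k n G creation (V f) = lift_map k n J f"
proof -
  let ?t = "\<lambda>\<beta>. basis_tensor \<beta> (sqrt_op G (defect k n G creation)
          (foldr (\<lambda>i. adj G (word_op (creation i) (\<beta> i))) [1..<Suc k] (V f)))"
  have t: "?t \<beta> = basis_tensor \<beta> (coord (lift_map k n J f) \<beta>)" if \<beta>: "\<beta> \<in> multiwords k n" for \<beta>
  proof -
    have "foldr (\<lambda>i. adj G (word_op (creation i) (\<beta> i))) xs (V f) = V (foldr (\<lambda>i. lower i (\<beta> i)) xs f)
        \<and> foldr (\<lambda>i. lower i (\<beta> i)) xs f \<in> F" if "set xs \<subseteq> {1..k}" for xs
      using that
    proof (induction xs)
      case (Cons i xs)
      then show ?case using set_multiword[OF \<beta>] by (simp add: adj_word_op lower_fock)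
    qed (use f in simp)
    moreover have "set [1..<Suc k] \<subseteq> {1..k}" by auto
    ultimately have *: "foldr (\<lambda>i. adj G (word_op (creation i) (\<beta> i))) [1..<Suc k] (V f)
          = V (foldr (\<lambda>i. lower i (\<beta> i)) [1..<Suc k] f)"
        "foldr (\<lambda>i. lower i (\<beta> i)) [1..<Suc k] f \<in> F" by blast+
    show ?thesis
      unfolding *(1) sqrt_defect_V[OF *(2)] coord_foldr_lower_empty_word[OF \<beta>] coord_lift_J[OF f]
      using \<beta> by simp
  qed
  have "((\<lambda>\<beta>. basis_tensor \<beta> (coord (lift_map k n J f) \<beta>)) has_sum lift_map k n J f) (multiwords k n)
    \<longleftrightarrow> ((\<lambda>\<beta>. basis_tensor \<beta> (coord (lift_map k n J f) \<beta>)) has_sum lift_map k n J f) UNIV"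
    by (rule has_sum_cong_neutral) (auto simp: coord_lift_J[OF f] basis_tensor_zero)
  then have "((\<lambda>\<beta>. basis_tensor \<beta> (coord (lift_map k n J f) \<beta>)) has_sum lift_map k n J f) (multiwords k n)"
    using has_sum_basis_tensor by blast
  then show ?thesis
    unfolding berezin_kernel_def by (subst infsum_cong[OF t]) (auto intro: infsumI)
qed

text \<open>The Berezin kernel preserves inner products and intertwines the length projections of
  \<open>F\<close> and of its target, so the compressed operator is the length projection
  transported by \<open>V\<close>.\<close>

lemma adj_berezin_kernel_length_proj:
  assumes f: "f \<in> F"
  shows "adj G (berezin_kernel k n G creation) (length_proj k q (berezin_kernel k n G creation (V f)))
    = V (length_proj k q f)"
proof (rule adj_eqI[OF csubspace_G])
  have pf: "length_proj k q f \<in> F" by (rule length_proj_fock[OF csubspace_E f])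
  then show "V (length_proj k q f) \<in> G" by (rule V_mem)
  fix z assume "z \<in> G"
  then obtain g where g: "g \<in> F" "z = V g" by (rule V_cases)
  show "cinner (berezin_kernel k n G creation z) (length_proj k q (berezin_kernel k n G creation (V f)))
    = cinner z (V (length_proj k q f))"
    unfolding g(2) berezin_kernel_V[OF g(1)] berezin_kernel_V[OF f]
      length_proj_lift_J[OF f] cinner_lift_J[OF g(1) pf] cinner_V[OF g(1) pf] ..
qed

end

text \<open>Split off the last coordinate and sum the smaller simplices by the hockey-stick
  identity. Finiteness is part of the induction because the cardinality of the disjoint union needs
  it.\<close>

lemma count_bounded_sums:
  "finite {q \<in> {1..k} \<rightarrow>\<^sub>E (UNIV :: nat set). (\<Sum>i=1..k. q i) \<le> m} \<and>
   card {q \<in> {1..k} \<rightarrow>\<^sub>E (UNIV :: nat set). (\<Sum>i=1..k. q i) \<le> m} = (m + k) choose k"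
proof (induction k arbitrary: m)
  case 0
  then show ?case by simp
next
  case (Suc k)
  define A where "A = (\<lambda>(k :: nat) (m :: nat). {q \<in> {1..k} \<rightarrow>\<^sub>E (UNIV :: nat set). (\<Sum>i=1..k. q i) \<le> m})"
  have IH: "finite (A k m)" "card (A k m) = (m + k) choose k" for m
    using Suc.IH[of m] by (simp_all add: A_def)
  have sum_upd: "(\<Sum>i=1..k. (q(Suc k := t)) i) = (\<Sum>i=1..k. q i)" for q :: "nat \<Rightarrow> nat" and t
    by (intro sum.cong) auto
  \<comment> \<open>The inverse resets the last coordinate to \<open>undefined\<close>, so that the
    shorter tuple is again extensional.\<close>
  have bij: "bij_betw (\<lambda>(t, q). q(Suc k := t)) (SIGMA t:{..m}. A k (m - t)) (A (Suc k) m)"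
  proof (rule bij_betw_byWitness[where f' = "\<lambda>q. (q (Suc k), q(Suc k := undefined))"])
    show "\<forall>a\<in>SIGMA t:{..m}. A k (m - t). (\<lambda>q. (q (Suc k), q(Suc k := undefined))) ((\<lambda>(t, q). q(Suc k := t)) a) = a"
      by (auto simp: A_def PiE_iff extensional_def fun_eq_iff)
    show "\<forall>q\<in>A (Suc k) m. (\<lambda>(t, q). q(Suc k := t)) (q (Suc k), q(Suc k := undefined)) = q"
      by simp
    show "(\<lambda>(t, q). q(Suc k := t)) ` (SIGMA t:{..m}. A k (m - t)) \<subseteq> A (Suc k) m"
      by (auto simp: A_def PiE_iff extensional_def sum_upd[unfolded One_nat_def])
    show "(\<lambda>q. (q (Suc k), q(Suc k := undefined))) ` A (Suc k) m \<subseteq> (SIGMA t:{..m}. A k (m - t))"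
      by (auto simp: A_def PiE_iff extensional_def sum_upd[unfolded One_nat_def])
  qed
  have "card (A (Suc k) m) = card (SIGMA t:{..m}. A k (m - t))"
    using bij_betw_same_card[OF bij] by simp
  also have "\<dots> = (\<Sum>t\<le>m. (m - t + k) choose k)"
    by (simp add: card_SigmaI IH)
  also have "\<dots> = (\<Sum>s\<le>m. (k + s) choose k)"
    by (rule sum.reindex_bij_witness[of _ "\<lambda>s. m - s" "\<lambda>t. m - t"]) (auto simp: add.commute)
  also have "\<dots> = (\<Sum>s\<le>m. (k + s) choose s)"
    by (intro sum.cong refl) (simp add: binomial_symmetric[of k "k + _"])
  also have "\<dots> = (m + Suc k) choose m"
    using sum_choose_lower[of k m] by (simp add: add.commute)
  also have "\<dots> = (m + Suc k) choose Suc k"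
    using binomial_symmetric[of m "m + Suc k"] by simp
  finally have c: "card (A (Suc k) m) = (m + Suc k) choose Suc k" .
  have "finite (A (Suc k) m)"
    using bij_betw_finite[OF bij] IH by (simp add: finite_SigmaI)
  then show ?case using c by (simp add: A_def)
qed

section \<open>Traces and curvature in a model\<close>

context fock_model
begin

text \<open>Ensures that the choice in \<open>op_trace\<close> is a genuine basis. The witness
  consists of the images of the elementary tensors with coefficients in \<open>W\<close>; it is
  total because finite sums of elementary tensors are dense in \<open>F\<close>.\<close>

lemma orthonormal_basis_exists:
  assumes W: "finite W" "orthonormal W" "E = cspan W"
  shows "\<exists>B. orthonormal_basis G B"
proof
  define B where "B = (\<lambda>(\<beta>, w). V (basis_tensor \<beta> w)) ` (multiwords k n \<times> W)"
  have WE: "w \<in> E" if "w \<in> W" for w using that W(3) by (simp add: complex_vector.span_base)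
  have bF: "basis_tensor \<beta> e \<in> F" if "\<beta> \<in> multiwords k n" "e \<in> E" for \<beta> e
    by (rule basis_tensor_fock[OF csubspace_E that])
  have BG: "B \<subseteq> G" using bF WE by (auto simp: B_def intro!: V_mem)
  have on: "cinner x y = (if x = y then 1 else 0)" if "x \<in> B" "y \<in> B" for x y
  proof -
    obtain \<beta> w \<gamma> v where x: "\<beta> \<in> multiwords k n" "w \<in> W" "x = V (basis_tensor \<beta> w)"
      and y: "\<gamma> \<in> multiwords k n" "v \<in> W" "y = V (basis_tensor \<gamma> v)"
      using \<open>x \<in> B\<close> \<open>y \<in> B\<close> by (auto simp: B_def)
    have "cinner x y = (if \<beta> = \<gamma> \<and> w = v then 1 else 0)"
      using x y W(2) by (simp add: cinner_V bF WE cinner_basis_tensor orthonormal_def)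
    moreover have "cinner x x = 1"
      using x W(2) by (simp add: cinner_V bF WE cinner_basis_tensor orthonormal_def)
    ultimately show ?thesis using x(3) y(3) by auto
  qed
  have "closure (cspan B) \<subseteq> G"
    using complex_vector.span_minimal[OF BG csubspace_G]
      closure_minimal[OF _ closed_G] closed_cspan_orthonormal[OF W(1,2)] W(3) by blast
  moreover have "V f \<in> closure (cspan B)" if f: "f \<in> F" for f
    unfolding closure_approachable
  proof (intro allI impI)
    fix \<epsilon> :: real assume "0 < \<epsilon>"
    then obtain A where "finite A" and A: "dist (\<Sum>\<beta>\<in>A. basis_tensor \<beta> (coord f \<beta>)) f \<le> \<epsilon> / 2"
      using has_sum_finite_approximation[OF has_sum_basis_tensor[of f], of "\<epsilon> / 2"] by auto
    define g where "g = (\<Sum>\<beta>\<in>A. basis_tensor \<beta> (coord f \<beta>))"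
    \<comment> \<open>The finite set \<open>A\<close> may contain indices that are no multiwords;
      their coefficients are zero.\<close>
    have bA: "basis_tensor \<beta> (coord f \<beta>) \<in> F \<and> V (basis_tensor \<beta> (coord f \<beta>)) \<in> cspan B" for \<beta>
    proof (cases "\<beta> \<in> multiwords k n")
      case True
      have "coord f \<beta> \<in> cspan W" using coord_mem[OF f] W(3) by simp
      then have "basis_tensor \<beta> (coord f \<beta>) = basis_tensor \<beta> (\<Sum>w\<in>W. cinner (coord f \<beta>) w *\<^sub>C w)"
        by (simp only: orthonormal_expansion[OF W(1,2)])
      also have "\<dots> = (\<Sum>w\<in>W. cinner (coord f \<beta>) w *\<^sub>C basis_tensor \<beta> w)"
        by (simp only: basis_tensor_sum basis_tensor_scaleC)
      finally have "V (basis_tensor \<beta> (coord f \<beta>)) = V (\<Sum>w\<in>W. cinner (coord f \<beta>) w *\<^sub>C basis_tensor \<beta> w)"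
        by simp
      also have "\<dots> = (\<Sum>w\<in>W. cinner (coord f \<beta>) w *\<^sub>C V (basis_tensor \<beta> w))"
        using True by (subst V_sum)
          (auto simp: V_scaleC bF WE intro: complex_vector.subspace_scale[OF csubspace_F])
      also have "\<dots> \<in> cspan B"
        using True by (intro complex_vector.span_sum complex_vector.span_scale complex_vector.span_base)
          (auto simp: B_def)
      finally show ?thesis using True bF coord_mem[OF f] by blast
    next
      case False
      then have "coord f \<beta> = 0" using f by (simp add: fock_def)
      then show ?thesis
        by (simp add: basis_tensor_zero V_zero complex_vector.subspace_0[OF csubspace_F] complex_vector.span_zero)
    qed
    have gF: "g \<in> F" unfolding g_def using bA by (intro complex_vector.subspace_sum[OF csubspace_F]) blast
    have "V g \<in> cspan B"
      unfolding g_def using bA by (subst V_sum) (auto intro: complex_vector.span_sum)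
    moreover have "dist (V g) (V f) = dist g f"
      using norm_V[OF complex_vector.subspace_diff[OF csubspace_F gF f]] by (simp add: dist_norm V_diff gF f)
    ultimately show "\<exists>y\<in>cspan B. dist y (V f) < \<epsilon>"
      using A \<open>0 < \<epsilon>\<close> by (intro bexI[of _ "V g"]) (auto simp: g_def)
  qed
  ultimately have "closure (cspan B) = G" using image_V by blast
  then show "orthonormal_basis G B"
    using BG on by (simp add: orthonormal_basis_def)
qed

text \<open>For \<open>e\<close> in the chosen basis \<open>B\<close>, expand
  \<open>cinner (A e) e\<close> in the finite orthonormal system of images of elementary tensors of
  length \<open>q\<close>. Exchanging this finite sum with the sum over \<open>B\<close> leaves, for
  each member of the system, its squared norm in the basis \<open>B\<close>, which is 1 by
  Parseval.\<close>

lemma op_trace_length_proj: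
  assumes W: "finite W" "orthonormal W" "E = cspan W"
    and A: "\<And>f. f \<in> F \<Longrightarrow> A (V f) = V (length_proj k q f)"
  shows "op_trace G A = of_nat (card (words_of_length k n q) * card W)"
proof -
  let ?N = "words_of_length k n q"
  define B where "B = (SOME B. orthonormal_basis G B)"
  have B: "orthonormal_basis G B"
    unfolding B_def by (rule someI_ex) (rule orthonormal_basis_exists[OF W])
  have BG: "B \<subseteq> G" using B by (simp add: orthonormal_basis_def)
  have WE: "w \<in> E" if "w \<in> W" for w using that W(3) by (simp add: complex_vector.span_base)
  have bF: "basis_tensor \<beta> w \<in> F" if "\<beta> \<in> ?N" "w \<in> W" for \<beta> w
    using that WE by (intro basis_tensor_fock[OF csubspace_E]) (auto simp: words_of_length_def)
  have summand: "cinner (A e) e = (\<Sum>\<beta>\<in>?N. \<Sum>w\<in>W. of_real ((cmod (cinner (V (basis_tensor \<beta> w)) e))\<^sup>2))"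
    if "e \<in> B" for e
  proof -
    obtain f where f: "f \<in> F" "e = V f" using \<open>e \<in> B\<close> BG V_cases by blast
    have "cinner (A e) e = cinner (length_proj k q f) f"
      using f by (simp add: A cinner_V length_proj_fock[OF csubspace_E])
    also have "\<dots> = (\<Sum>\<^sub>\<infinity>\<beta>\<in>?N. cinner (coord f \<beta>) (coord f \<beta>))"
      unfolding cinner_l2_def
      by (rule infsum_cong_neutral) (use f(1) in \<open>auto simp: length_proj.rep_eq words_of_length_def fock_def\<close>)
    also have "\<dots> = (\<Sum>\<beta>\<in>?N. cinner (coord f \<beta>) (coord f \<beta>))"
      by (simp add: finite_words_of_length)
    also have "\<dots> = (\<Sum>\<beta>\<in>?N. \<Sum>w\<in>W. of_real ((cmod (cinner (V (basis_tensor \<beta> w)) e))\<^sup>2))"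
    proof (rule sum.cong[OF refl])
      fix \<beta> assume \<beta>: "\<beta> \<in> ?N"
      have "coord f \<beta> \<in> cspan W" using coord_mem[OF f(1)] W(3) by simp
      from orthonormal_parseval_finite[OF W(1,2) this, of "coord f \<beta>"]
      have "cinner (coord f \<beta>) (coord f \<beta>) = (\<Sum>w\<in>W. cinner w (coord f \<beta>) * cinner (coord f \<beta>) w)"
        by (simp only: mult.commute)
      also have "\<dots> = (\<Sum>w\<in>W. of_real ((cmod (cinner w (coord f \<beta>)))\<^sup>2))"
        by (simp only: cinner_mult_cnj)
      also have "\<dots> = (\<Sum>w\<in>W. of_real ((cmod (cinner (V (basis_tensor \<beta> w)) e))\<^sup>2))"
      proof (rule sum.cong[OF refl])
        fix w assume "w \<in> W"
        then have "cinner (V (basis_tensor \<beta> w)) e = cinner (basis_tensor \<beta> w) f"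
          using f \<beta> bF by (simp add: cinner_V)
        also have "\<dots> = cnj (cinner (coord f \<beta>) w)"
          using cinner_commute[of "basis_tensor \<beta> w" f] by (simp only: cinner_basis_tensor_right)
        also have "\<dots> = cinner w (coord f \<beta>)" by (rule cinner_commute[symmetric])
        finally show "complex_of_real ((cmod (cinner w (coord f \<beta>)))\<^sup>2)
            = of_real ((cmod (cinner (V (basis_tensor \<beta> w)) e))\<^sup>2)" by simp
      qed
      finally show "cinner (coord f \<beta>) (coord f \<beta>)
          = (\<Sum>w\<in>W. of_real ((cmod (cinner (V (basis_tensor \<beta> w)) e))\<^sup>2))" .
    qed
    finally show ?thesis .
  qed
  have one: "((\<lambda>e. complex_of_real ((cmod (cinner (V (basis_tensor \<beta> w)) e))\<^sup>2)) has_sum 1) B"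
    if "\<beta> \<in> ?N" "w \<in> W" for \<beta> w
  proof -
    have "complex_of_real ((norm (V (basis_tensor \<beta> w)))\<^sup>2) = 1"
      unfolding cinner_self[symmetric] using that W(2) bF
      by (simp add: cinner_V cinner_basis_tensor orthonormal_def)
    then show ?thesis
      using has_sum_of_real[OF parseval[OF B V_mem[OF bF[OF that]]], where 'a = complex] by simp
  qed
  have "((\<lambda>e. cinner (A e) e) has_sum (\<Sum>\<beta>\<in>?N. \<Sum>w\<in>W. 1)) B"
    by (subst has_sum_cong[OF summand], assumption) (intro has_sum_sum one)
  then show ?thesis
    unfolding op_trace_def B_def[symmetric] by (subst infsumI) auto
qed

lemma curv_eq:
  assumes n: "\<forall>i\<in>{1..k}. 1 \<le> n i" and W: "finite W" "orthonormal W" "E = cspan W"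
  shows "curv k n G creation = card W"
proof -
  have one: "cspan {1} = (UNIV :: complex set)"
  proof -
    have "x \<in> cspan {1}" for x :: complex
      using complex_vector.span_scale[OF complex_vector.span_base[of "1::complex" "{1}"], of x]
      by (simp add: scaleC_complex_def)
    then show ?thesis by auto
  qed
  \<comment> \<open>The denominator is covered by the same trace formula: the scalar Fock space is a
    model of itself, with the basis \<open>{1}\<close> of its coefficients.\<close>
  have std: "fock_model k n (UNIV :: complex set) (\<lambda>f. f) (fock k n UNIV)"
    by unfold_locales (auto simp: unitary_op_def bounded_op_def intro!: exI[of _ 1] complex_vector.subspace_UNIV)
  have tr1: "op_trace (fock k n (UNIV :: complex set)) (length_proj k q) = of_nat (card (words_of_length k n q))" for q
    using fock_model.op_trace_length_proj[OF std, of "{1}" "length_proj k q" q] one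
    by (simp add: orthonormal_def cinner_complex_def)
  have tr: "op_trace G (\<lambda>h. adj G (berezin_kernel k n G creation)
      (length_proj k q (berezin_kernel k n G creation h))) = of_nat (card (words_of_length k n q) * card W)" for q
    by (rule op_trace_length_proj[OF W]) (rule adj_berezin_kernel_length_proj)
  have nz: "card (words_of_length k n q) \<noteq> 0" for q
    using words_of_length_nonempty[OF n] finite_words_of_length by simp
  have "1 / real ((m + k) choose k) *
     (\<Sum>q \<in> {q \<in> {1..k} \<rightarrow>\<^sub>E UNIV. (\<Sum>i=1..k. q i) \<le> m}.
        Re (op_trace G (\<lambda>h. adj G (berezin_kernel k n G creation) (length_proj k q (berezin_kernel k n G creation h))))
        / Re (op_trace (fock k n (UNIV :: complex set)) (length_proj k q))) = card W" for m
    unfolding tr tr1 using nz count_bounded_sums[of k m] by simp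
  then show ?thesis unfolding curv_def by (simp add: limI)
qed

end

section \<open>Fock space models of Beurling type subspaces\<close>

text \<open>Polarization: norms determine the real part, and replacing \<open>y\<close> by
  \<open>\<i> *\<^sub>C y\<close> the imaginary part. It passes from the norm condition in
  \<open>partial_isometry\<close> to the inner products in \<open>unitary_op\<close>.\<close>

lemma cinner_eq_if_norm_eq:
  fixes A :: "'a::complex_inner \<Rightarrow> 'b::complex_inner"
  assumes L: "csubspace L" and add: "\<And>x y. x \<in> L \<Longrightarrow> y \<in> L \<Longrightarrow> A (x + y) = A x + A y"
    and scale: "\<And>c x. x \<in> L \<Longrightarrow> A (c *\<^sub>C x) = c *\<^sub>C A x"
    and norm: "\<And>x. x \<in> L \<Longrightarrow> norm (A x) = norm x" and xy: "x \<in> L" "y \<in> L"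
  shows "cinner (A x) (A y) = cinner x y"
proof -
  have re: "inner (A x) (A y) = inner x y" if "x \<in> L" "y \<in> L" for x y
    using that complex_vector.subspace_add[OF L that] by (simp add: dot_norm norm flip: add)
  have "\<i> *\<^sub>C y \<in> L" using complex_vector.subspace_scale[OF L xy(2)] .
  then show ?thesis
    using re[OF xy] re[OF xy(1), of "\<i> *\<^sub>C y"] scale[OF xy(2), of \<i>]
    by (intro complex_eqI) (simp_all add: Im_cinner inner_eq_Re_cinner[symmetric])
qed

section \<open>Transport of models and finite rank\<close>

context fock_model
begin

text \<open>Serves both directions of the theorem: it carries a model along a given equivalence, and
  it exchanges the coefficient space of a model.\<close>

lemma compose:
  assumes U: "unitary_op G H U"
    and intU: "\<And>i j x. i \<in> {1..k} \<Longrightarrow> j \<in> {1..n i} \<Longrightarrow> x \<in> G \<Longrightarrow> U (creation i j x) = creation i j (U x)"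
  shows "fock_model k n E (\<lambda>f. U (V f)) H"
proof
  obtain b where b: "\<forall>x\<in>G. norm (U x) \<le> b * norm x"
    using U by (auto simp: unitary_op_def bounded_op_def)
  have "norm (U (V f)) \<le> b * norm f" if "f \<in> F" for f
    using b V_mem[OF that] norm_V[OF that] by auto
  moreover have "(\<lambda>f. U (V f)) ` F = H"
    using U image_V by (auto simp: unitary_op_def)
  ultimately show "unitary_op F H (\<lambda>f. U (V f))"
    using U unfolding unitary_op_def bounded_op_def by (auto simp: V_mem V_add V_scaleC cinner_V)
qed (simp_all add: csubspace_E intertwines intU V_mem)

text \<open>The defect fixes the isometric copy of \<open>E\<close> under \<open>J\<close>. An
  orthonormal set in \<open>E\<close> thus yields an orthonormal, hence independent, set of the same
  size in the finite-dimensional \<open>cspan B\<close>.\<close>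

lemma finite_rank_spanning_set:
  assumes "finite_rank k n G creation"
  shows "\<exists>W. finite W \<and> orthonormal W \<and> cspan W = E"
proof -
  obtain B where B: "finite B" "defect k n G creation ` G \<subseteq> cspan B"
    using assms by (auto simp: finite_rank_def finite_rank_op_def)
  show ?thesis
  proof (rule orthonormal_spanning_set[OF csubspace_E, where m = "card B"])
    fix A assume A: "finite A" "orthonormal A" "A \<subseteq> E"
    have inj: "inj_on J A"
    proof (rule inj_onI)
      fix x y assume xy: "x \<in> A" "y \<in> A" "J x = J y"
      then have "x \<in> E" "y \<in> E" using A(3) by auto
      then have "cinner x y = cinner x x" using cinner_J[of x x] cinner_J[of x y] xy(3) by simp
      moreover have "cinner x x = 1" "cinner x y = (if x = y then 1 else 0)"
        using A(2) xy(1,2) by (auto simp: orthonormal_def)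
      ultimately show "x = y" by (simp split: if_splits)
    qed
    moreover have "orthonormal (J ` A)"
    proof -
      have "cinner (J x) (J y) = (if J x = J y then 1 else 0)" if "x \<in> A" "y \<in> A" for x y
      proof -
        have "cinner (J x) (J y) = cinner x y" using that A(3) by (intro cinner_J) auto
        also have "\<dots> = (if x = y then 1 else 0)" using A(2) that by (simp add: orthonormal_def)
        finally show ?thesis using inj_on_eq_iff[OF inj that] by simp
      qed
      then show ?thesis by (simp add: orthonormal_def)
    qed
    moreover have "J ` A \<subseteq> cspan B"
    proof -
      have "J e \<in> cspan B" if "e \<in> A" for e
      proof -
        have e: "e \<in> E" using that A by blast
        have "defect k n G creation (J e) \<in> cspan B" using B(2) V_mem[OF vacuum_mem[OF e]] by blast
        then show ?thesis by (simp add: defect_V[OF vacuum_mem[OF e]] basis_tensor.rep_eq)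
      qed
      then show ?thesis by blast
    qed
    ultimately show "card A \<le> card B"
      using card_orthonormal_le[OF B(1)] by (metis card_image)
  qed
qed

end

text \<open>The equivalence is \<open>V'\<close> after the inverse of \<open>V\<close>; isometry
  makes \<open>V\<close> injective, so \<open>inv_into\<close> really inverts it.\<close>

lemma unitarily_equivalent_if_models:
  assumes "fock_model k n E V M" "fock_model k n E V' N"
  shows "unitarily_equivalent k n M N"
proof -
  interpret A: fock_model k n E V M by fact
  interpret B: fock_model k n E V' N by fact
  define U where "U = (\<lambda>x. V' (inv_into A.F V x))"
  have "inj_on V A.F"
  proof (rule inj_onI)
    fix f g assume fg: "f \<in> A.F" "g \<in> A.F" "V f = V g"
    then have "norm (f - g) = 0"
      using A.norm_V[OF complex_vector.subspace_diff[OF A.csubspace_F]] A.V_diff by force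
    then show "f = g" by simp
  qed
  then have U: "U (V f) = V' f" if "f \<in> A.F" for f
    using that by (simp add: U_def inv_into_f_f)
  have "U ` M = N"
    unfolding A.image_V[symmetric] B.image_V[symmetric] image_image using U by (rule image_cong[OF refl])
  moreover have "U (x + y) = U x + U y" if "x \<in> M" "y \<in> M" for x y
    using that by (elim A.V_cases)
      (simp flip: A.V_add add: U B.V_add complex_vector.subspace_add[OF A.csubspace_F])
  moreover have "U (c *\<^sub>C x) = c *\<^sub>C U x" if "x \<in> M" for c x
    using that by (elim A.V_cases)
      (simp flip: A.V_scaleC add: U B.V_scaleC complex_vector.subspace_scale[OF A.csubspace_F])
  moreover have "cinner (U x) (U y) = cinner x y" if "x \<in> M" "y \<in> M" for x y
    using that by (elim A.V_cases) (simp add: U A.cinner_V B.cinner_V)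
  moreover have "norm (U x) \<le> 1 * norm x" if "x \<in> M" for x
    using that by (elim A.V_cases) (simp add: U A.norm_V B.norm_V)
  ultimately have "unitary_op M N U"
    unfolding unitary_op_def bounded_op_def by blast
  moreover have "U (creation i j x) = creation i j (U x)" if "i \<in> {1..k}" "j \<in> {1..n i}" "x \<in> M" for i j x
  proof -
    obtain f where f: "f \<in> A.F" "x = V f" using \<open>x \<in> M\<close> by (rule A.V_cases)
    show ?thesis
      using that(1,2) f by (simp add: U B.intertwines creation_fock[OF A.csubspace_E] flip: A.intertwines)
  qed
  ultimately show ?thesis unfolding unitarily_equivalent_def by blast
qed

text \<open>Creation operators act on indices and \<open>J\<close> acts on coefficients, so they
  commute; a unitary between coefficient spaces therefore lifts to a model.\<close>

lemma fock_model_lift_map: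
  assumes E: "csubspace E" and E': "csubspace E'"
    and add: "\<And>x y. x \<in> E \<Longrightarrow> y \<in> E \<Longrightarrow> J (x + y) = J x + J y"
    and scale: "\<And>c x. x \<in> E \<Longrightarrow> J (c *\<^sub>C x) = c *\<^sub>C J x"
    and cinner: "\<And>x y. x \<in> E \<Longrightarrow> y \<in> E \<Longrightarrow> cinner (J x) (J y) = cinner x y"
    and image: "J ` E = E'"
  shows "fock_model k n E (lift_map k n J) (fock k n E')"
proof
  have norm: "norm (J x) = norm x" if "x \<in> E" for x
    by (rule norm_eq_if_cinner_eq[of E J, OF _ that]) (rule cinner)
  have J0: "J 0 = 0" using norm[of 0] complex_vector.subspace_0[OF E] by simp
  have c: "coord (lift_map k n J f) \<beta> = (if \<beta> \<in> multiwords k n then J (coord f \<beta>) else 0)"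
    if "f \<in> fock k n E" for f \<beta>
    by (rule coord_lift_map[OF that]) (rule norm)
  have memE: "coord f \<beta> \<in> E" if "f \<in> fock k n E" "\<beta> \<in> multiwords k n" for f \<beta>
    using that by (simp add: fock_def)
  have mem: "lift_map k n J f \<in> fock k n E'" if f: "f \<in> fock k n E" for f
  proof -
    have "J (coord f \<beta>) \<in> E'" if "\<beta> \<in> multiwords k n" for \<beta>
      using image memE[OF f that] by blast
    then show ?thesis by (simp add: fock_def c[OF f])
  qed
  have inner: "cinner (lift_map k n J f) (lift_map k n J g) = cinner f g"
    if "f \<in> fock k n E" "g \<in> fock k n E" for f g
    by (rule cinner_lift_map[OF that]) (rule cinner)
  have "lift_map k n J (f + g) = lift_map k n J f + lift_map k n J g"
    if "f \<in> fock k n E" "g \<in> fock k n E" for f g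
    using that complex_vector.subspace_add[OF csubspace_fock[OF E] that]
    by (intro l2_eqI) (simp add: c plus_l2.rep_eq add memE)
  moreover have "lift_map k n J (a *\<^sub>C f) = a *\<^sub>C lift_map k n J f"
    if "f \<in> fock k n E" for f a
    using that complex_vector.subspace_scale[OF csubspace_fock[OF E] that]
    by (intro l2_eqI) (simp add: c coord_scaleC scale memE)
  moreover have "norm (lift_map k n J f) \<le> 1 * norm f" if "f \<in> fock k n E" for f
    using norm_eq_if_cinner_eq[of "fock k n E" "lift_map k n J", OF inner that] by simp
  moreover have "g \<in> lift_map k n J ` fock k n E" if g: "g \<in> fock k n E'" for g
  proof -
    \<comment> \<open>Surjectivity: invert coefficient by coefficient. The inverse preserves norms
      too, so the resulting family is square-summable.\<close>
    define J' where "J' = inv_into E J"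
    have J': "J' y \<in> E" "J (J' y) = y" if "y \<in> E'" for y
      using that image by (auto simp: J'_def inv_into_into f_inv_into_f)
    have "norm (J' y) = norm y" if "y \<in> E'" for y
      using norm[OF J'(1)[OF that]] J'(2)[OF that] by simp
    then have c': "coord (lift_map k n J' g) \<beta> = (if \<beta> \<in> multiwords k n then J' (coord g \<beta>) else 0)" for \<beta>
      by (intro coord_lift_map[OF g])
    have gE: "coord g \<beta> \<in> E'" if "\<beta> \<in> multiwords k n" for \<beta> using that g by (simp add: fock_def)
    then have m: "lift_map k n J' g \<in> fock k n E" by (simp add: fock_def c' J')
    have "lift_map k n J (lift_map k n J' g) = g"
      using g by (intro l2_eqI) (simp add: c[OF m] c' J' gE fock_def)
    then show ?thesis using m by force
  qed
  ultimately show "unitary_op (fock k n E) (fock k n E') (lift_map k n J)"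
    unfolding unitary_op_def bounded_op_def using mem inner by blast
  fix i j and f assume ij: "i \<in> {1..k}" "j \<in> {1..n i}" and f: "f \<in> fock k n E"
  have cf: "creation i j f \<in> fock k n E" by (rule creation_fock[where n = n, OF E ij f])
  have cf': "creation i j (lift_map k n J f) \<in> fock k n E'"
    by (rule creation_fock[where n = n, OF E' ij mem[OF f]])
  show "lift_map k n J (creation i j f) = creation i j (lift_map k n J f)"
  proof (rule l2_eqI)
    fix \<beta> :: multiword
    show "coord (lift_map k n J (creation i j f)) \<beta> = coord (creation i j (lift_map k n J f)) \<beta>"
    proof (cases "\<beta> \<in> multiwords k n")
      case True
      have "set (tl (\<beta> i)) \<subseteq> {1..n i}"
        using set_multiword[OF True ij(1)] by (cases "\<beta> i") auto
      then have "\<beta>(i := tl (\<beta> i)) \<in> multiwords k n" by (rule multiwords_upd[OF True ij(1)])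
      then show ?thesis using True by (simp add: c[OF cf] creation.rep_eq c[OF f] J0)
    next
      case False
      then show ?thesis using cf' mem[OF cf] by (simp add: fock_def)
    qed
  qed
qed (rule E)

text \<open>Orthonormal bases of equal size give a unitary between their spans, even across types;
  lifting it changes the coefficient space of the Fock space.\<close>

lemma fock_model_equal_card:
  assumes W: "finite W" "orthonormal W" and W': "finite W'" "orthonormal W'" and card: "card W = card W'"
  shows "\<exists>V. fock_model k n (cspan W) V (fock k n (cspan W'))"
proof -
  obtain b where b: "bij_betw b W W'"
    using finite_same_card_bij[OF W(1) W'(1) card] by blast
  have bW: "b w \<in> W'" if "w \<in> W" for w using b that by (auto simp: bij_betw_def)
  \<comment> \<open>The linear extension of \<open>b\<close>, preceded by the orthogonal projection
    onto \<open>cspan W\<close>; only its values on the span matter.\<close>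
  define J where "J = (\<lambda>x. \<Sum>w\<in>W. cinner x w *\<^sub>C b w)"
  have mem: "J x \<in> cspan W'" for x
    unfolding J_def by (intro complex_vector.span_sum complex_vector.span_scale complex_vector.span_base bW)
  have Jb: "J x = (\<Sum>w'\<in>W'. cinner x (inv_into W b w') *\<^sub>C w')" for x
    unfolding J_def using b
    by (intro sum.reindex_bij_witness[of _ "inv_into W b" b])
       (auto simp: bij_betw_def inv_into_f_f f_inv_into_f inv_into_into)
  have coeff: "cinner (J x) (b w) = cinner x w" if "w \<in> W" for x w
    unfolding Jb using cinner_orthonormal_sum[OF W' bW[OF that], of "\<lambda>w'. cinner x (inv_into W b w')"] b that
    by (simp add: bij_betw_def inv_into_f_f)
  have cinner: "cinner (J x) (J y) = cinner x y" if "x \<in> cspan W" "y \<in> cspan W" for x y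
  proof -
    have "cinner (J x) (J y) = (\<Sum>w'\<in>W'. cinner (J x) w' * cinner w' (J y))"
      by (rule orthonormal_parseval_finite[OF W' mem])
    also have "\<dots> = (\<Sum>w\<in>W. cinner (J x) (b w) * cinner (b w) (J y))"
      by (rule sum.reindex_bij_betw[OF b, symmetric])
    also have "\<dots> = (\<Sum>w\<in>W. cinner x w * cinner w y)"
    proof (rule sum.cong[OF refl])
      fix w assume "w \<in> W"
      then show "cinner (J x) (b w) * cinner (b w) (J y) = cinner x w * cinner w y"
        using coeff[of w x] coeff[of w y] cinner_commute[of "b w" "J y"] cinner_commute[of w y] by simp
    qed
    also have "\<dots> = cinner x y" by (rule orthonormal_parseval_finite[OF W that(1), symmetric])
    finally show ?thesis .
  qed
  have "y \<in> J ` cspan W" if y: "y \<in> cspan W'" for y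
  proof -
    define x where "x = (\<Sum>w\<in>W. cinner y (b w) *\<^sub>C w)"
    have "J x = (\<Sum>w\<in>W. cinner y (b w) *\<^sub>C b w)"
      unfolding J_def x_def by (intro sum.cong refl) (simp add: cinner_orthonormal_sum[OF W])
    also have "\<dots> = (\<Sum>w'\<in>W'. cinner y w' *\<^sub>C w')"
      by (rule sum.reindex_bij_betw[OF b])
    also have "\<dots> = y" by (rule orthonormal_expansion[OF W' y])
    finally have "J x = y" .
    moreover have "x \<in> cspan W"
      unfolding x_def by (intro complex_vector.span_sum complex_vector.span_scale complex_vector.span_base)
    ultimately show ?thesis by blast
  qed
  then have "J ` cspan W = cspan W'" using mem by blast
  then have "fock_model k n (cspan W) (lift_map k n J) (fock k n (cspan W'))"
    by (intro fock_model_lift_map complex_vector.subspace_span cinner)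
       (simp_all add: J_def cinner_add_left cinner_scaleC_left scaleC_add_left sum.distrib
         complex_vector.scale_sum_right scaleC_scaleC)
  then show ?thesis by blast
qed

text \<open>On the orthogonal complement \<open>L\<close> of its kernel \<open>\<Psi>\<close> is isometric. Creation operators are isometric
  and commute with \<open>\<Psi>\<close>, so they cannot move \<open>L\<close> out of itself without losing norm under \<open>\<Psi>\<close>; hence \<open>L\<close> is
  reducing and therefore of the form \<open>fock k n E\<close>.\<close>

lemma inner_multi_analytic_model:
  fixes E :: "'e::chilbert_space set" and \<Psi> :: "(multiword, 'e) l2 \<Rightarrow> (multiword, 'h::chilbert_space) l2"
  assumes E: "closed_csubspace E" and \<Psi>: "inner_multi_analytic k n E UNIV \<Psi>"
  shows "\<exists>E'. fock_model k n (E' :: 'e set) \<Psi> (\<Psi> ` fock k n E)"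
proof -
  have sE: "csubspace E" and cE: "closed E" using E by (auto simp: closed_csubspace_def)
  define F where "F = fock k n E"
  have sF: "csubspace F" unfolding F_def by (rule csubspace_fock[OF sE])
  have cF: "closed F" unfolding F_def by (rule closed_fock[OF sE cE])
  have add: "\<Psi> (f + g) = \<Psi> f + \<Psi> g" if "f \<in> F" "g \<in> F" for f g
    using \<Psi> that by (auto simp: F_def inner_multi_analytic_def multi_analytic_def bounded_op_def)
  have scale: "\<Psi> (c *\<^sub>C f) = c *\<^sub>C \<Psi> f" if "f \<in> F" for f c
    using \<Psi> that by (auto simp: F_def inner_multi_analytic_def multi_analytic_def bounded_op_def)
  have int: "\<Psi> (creation i j f) = creation i j (\<Psi> f)" if "i \<in> {1..k}" "j \<in> {1..n i}" "f \<in> F" for i j f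
    using \<Psi> that by (auto simp: F_def inner_multi_analytic_def multi_analytic_def)
  have "\<exists>b. \<forall>f\<in>F. norm (\<Psi> f) \<le> b * norm f"
    using \<Psi> by (simp add: F_def inner_multi_analytic_def multi_analytic_def bounded_op_def)
  then obtain b where b: "\<And>f. f \<in> F \<Longrightarrow> norm (\<Psi> f) \<le> b * norm f" by blast
  have zero: "\<Psi> 0 = 0" using add[of 0 0] complex_vector.subspace_0[OF sF] by simp
  have diff: "\<Psi> (f - g) = \<Psi> f - \<Psi> g" if "f \<in> F" "g \<in> F" for f g
    using add[of "f - g" g] that complex_vector.subspace_diff[OF sF] by simp
  define K where "K = {f\<in>F. \<Psi> f = 0}"
  define L where "L = {f\<in>F. \<forall>z\<in>K. cinner f z = 0}"
  have sK: "csubspace K"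
    using sF zero unfolding complex_vector.subspace_def K_def
    by (auto simp: add scale complex_vector.scale_zero_right)
  \<comment> \<open>Boundedness of \<open>\<Psi>\<close> closes the kernel, so that the orthogonal
    decomposition of \<open>F\<close> is available.\<close>
  have cK: "closed K"
    unfolding closed_sequential_limits
  proof (intro allI impI, elim conjE)
    fix f l assume f: "\<forall>m. f m \<in> K" and l: "f \<longlonglongrightarrow> l"
    have fF: "f m \<in> F" "\<Psi> (f m) = 0" for m using f by (auto simp: K_def)
    have lF: "l \<in> F" using closed_sequentially[OF cF fF(1) l] .
    have "norm (\<Psi> l) \<le> b * norm (l - f m)" for m
      using b[OF complex_vector.subspace_diff[OF sF lF fF(1)[of m]]] by (simp add: diff lF fF)
    moreover have "(\<lambda>m. b * norm (l - f m)) \<longlonglongrightarrow> b * norm (l - l)"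
      by (intro tendsto_intros l)
    ultimately have "norm (\<Psi> l) \<le> b * norm (l - l)"
      by (intro LIMSEQ_le_const) auto
    then show "l \<in> K" using lF by (simp add: K_def)
  qed
  have sL: "csubspace L"
    using sF unfolding complex_vector.subspace_def L_def
    by (auto simp: cinner_add_left cinner_scaleC_left)
  have LF: "L \<subseteq> F" and KF: "K \<subseteq> F" by (auto simp: L_def K_def)
  have isoL: "norm (\<Psi> f) = norm f" if "f \<in> L" for f
  proof -
    have "partial_isometry F \<Psi>" using \<Psi> by (simp add: F_def inner_multi_analytic_def)
    then show ?thesis using that unfolding partial_isometry_def L_def K_def by blast
  qed
  have decomp: "\<exists>y\<in>K. f - y \<in> L" if "f \<in> F" for f
    using orthogonal_projection_exists[of K f] sK cK that complex_vector.subspace_diff[OF sF that] KF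
    unfolding L_def closed_csubspace_def by blast
  have image: "\<Psi> ` F = \<Psi> ` L"
  proof
    show "\<Psi> ` F \<subseteq> \<Psi> ` L"
    proof (rule image_subsetI)
      fix f assume f: "f \<in> F"
      then obtain y where y: "y \<in> K" "f - y \<in> L" using decomp by blast
      then have "\<Psi> f = \<Psi> (f - y)" using diff[OF f, of y] KF by (auto simp: K_def)
      then show "\<Psi> f \<in> \<Psi> ` L" using y by blast
    qed
  qed (use LF in blast)
  have orth: "cinner g f = 0" if "f \<in> L" "g \<in> K" for f g
    using that cinner_commute[of g f] by (simp add: L_def)
  \<comment> \<open>The double complement: what is orthogonal to \<open>L\<close> inside
    \<open>F\<close> lies in the kernel again.\<close>
  have perp: "f \<in> K" if f: "f \<in> F" and p: "\<And>g. g \<in> L \<Longrightarrow> cinner f g = 0" for f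
  proof -
    obtain y where y: "y \<in> K" "f - y \<in> L" using decomp f by blast
    have "cinner (f - y) (f - y) = 0"
      using p[OF y(2)] orth[OF y(2,1)] by (simp add: cinner_diff_left)
    then have "f = y" by (simp add: cinner_self)
    then show ?thesis using y by simp
  qed
  have crF: "creation i j f \<in> F" if "i \<in> {1..k}" "j \<in> {1..n i}" "f \<in> F" for i j f
    using creation_fock[where n = n, OF sE] that by (simp add: F_def)
  have loF: "lower i [j] f \<in> F" if "i \<in> {1..k}" "j \<in> {1..n i}" "f \<in> F" for i j f
    unfolding F_def by (rule lower_fock) (use that in \<open>simp_all add: F_def\<close>)
  have crK: "creation i j f \<in> K" if "i \<in> {1..k}" "j \<in> {1..n i}" "f \<in> K" for i j f
  proof -
    have "norm (creation i j (\<Psi> f)) = 0" using that by (simp add: norm_creation K_def)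
    then show ?thesis using that crF int by (simp add: K_def)
  qed
  \<comment> \<open>Let \<open>y\<close> be the kernel component of the created vector.
    \<open>\<Psi>\<close> kills \<open>y\<close> and is isometric on the rest, while intertwining
    shows that the full norm survives \<open>\<Psi>\<close>; Pythagoras leaves
    \<open>y = 0\<close>.\<close>
  have crL: "creation i j f \<in> L" if ij: "i \<in> {1..k}" "j \<in> {1..n i}" and f: "f \<in> L" for i j f
  proof -
    have fF: "f \<in> F" using f LF by blast
    obtain y where y: "y \<in> K" "creation i j f - y \<in> L" using decomp[OF crF[OF ij fF]] by blast
    have "norm (creation i j f - y) = norm (\<Psi> (creation i j f))"
      using isoL[OF y(2)] diff[OF crF[OF ij fF], of y] y(1) by (simp add: K_def)
    also have "\<dots> = norm (creation i j f)"
      using int[OF ij fF] isoL[OF f] by (simp add: norm_creation)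
    finally have "norm (creation i j f - y) = norm (creation i j f)" .
    moreover have "(norm (creation i j f))\<^sup>2 = (norm (creation i j f - y))\<^sup>2 + (norm y)\<^sup>2"
      using pythagoras[of "creation i j f - y" y] y by (simp add: L_def)
    ultimately have "y = 0" by simp
    then show ?thesis using y(2) by simp
  qed
  \<comment> \<open>By adjointness, invariance of \<open>K\<close> under creation gives invariance
    of \<open>L\<close> under lowering; \<open>crL\<close> gives the same for \<open>K\<close> in
    the next step.\<close>
  have loL: "lower i [j] f \<in> L" if ij: "i \<in> {1..k}" "j \<in> {1..n i}" and f: "f \<in> L" for i j f
  proof -
    have "cinner (lower i [j] f) z = 0" if "z \<in> K" for z
      using cinner_commute[of "lower i [j] f" z] cinner_creation[of i j z f] orth[OF f crK[OF ij that]] by simp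
    then show ?thesis using loF[OF ij] f LF by (auto simp: L_def)
  qed
  have loK: "lower i [j] f \<in> K" if ij: "i \<in> {1..k}" "j \<in> {1..n i}" and f: "f \<in> K" for i j f
  proof (rule perp)
    show "lower i [j] f \<in> F" using loF[OF ij] f KF by blast
    fix g assume g: "g \<in> L"
    have "cinner g (lower i [j] f) = cinner (creation i j g) f" by (rule cinner_creation[symmetric])
    also have "\<dots> = 0" using crL[OF ij g] f by (simp add: L_def)
    finally show "cinner (lower i [j] f) g = 0"
      using cinner_commute[of "lower i [j] f" g] by simp
  qed
  \<comment> \<open>The coefficients of the vacuum vectors in \<open>L\<close>.\<close>
  define E' where "E' = {e\<in>E. basis_tensor (empty_word k) e \<in> L}"
  have sE': "csubspace E'"
    using sE sL unfolding complex_vector.subspace_def E'_def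
    by (auto simp: basis_tensor_zero basis_tensor_add basis_tensor_scaleC)
  have L_eq: "L = fock k n E'"
  proof
    show "L \<subseteq> fock k n E'"
    proof
      fix f assume f: "f \<in> L"
      have "basis_tensor (empty_word k) (coord f \<beta>) \<in> L" if "\<beta> \<in> multiwords k n" for \<beta>
        by (rule basis_tensor_empty_word_mem[where E = E and n = n])
           (use sL LF crL loL f that in \<open>auto simp: F_def\<close>)
      then show "f \<in> fock k n E'"
        using f LF by (auto simp: F_def fock_def E'_def)
    qed
    \<comment> \<open>Orthogonality to \<open>K\<close> is checked coefficient by coefficient, which
      avoids limits of elementary tensors. As \<open>K\<close> is reducing as well, the coefficients
      of its elements give vacuum vectors in \<open>K\<close>, orthogonal to those in
      \<open>L\<close>.\<close>
    show "fock k n E' \<subseteq> L"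
    proof
      fix f assume f: "f \<in> fock k n E'"
      have "cinner (coord f \<beta>) (coord z \<beta>) = 0" if z: "z \<in> K" for z \<beta>
      proof (cases "\<beta> \<in> multiwords k n")
        case True
        have "basis_tensor (empty_word k) (coord z \<beta>) \<in> K"
          by (rule basis_tensor_empty_word_mem[where E = E and n = n])
             (use sK KF crK loK z True in \<open>auto simp: F_def\<close>)
        moreover have "basis_tensor (empty_word k) (coord f \<beta>) \<in> L"
          using f True by (simp add: fock_def E'_def)
        ultimately have "cinner (basis_tensor (empty_word k) (coord f \<beta>)) (basis_tensor (empty_word k) (coord z \<beta>)) = 0"
          by (simp add: L_def)
        then show ?thesis by (simp add: cinner_basis_tensor)
      next
        case False
        then show ?thesis using f by (simp add: fock_def)
      qed
      then have "cinner f z = 0" if "z \<in> K" for z using that by (simp add: cinner_l2_def)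
      moreover have "f \<in> F"
        using f fock_mono[of E' E k n] by (auto simp: F_def E'_def)
      ultimately show "f \<in> L" by (simp add: L_def)
    qed
  qed
  have addL: "\<Psi> (f + g) = \<Psi> f + \<Psi> g" if "f \<in> L" "g \<in> L" for f g using add that LF by blast
  have scaleL: "\<Psi> (c *\<^sub>C f) = c *\<^sub>C \<Psi> f" if "f \<in> L" for f c using scale that LF by blast
  have "cinner (\<Psi> f) (\<Psi> g) = cinner f g" if "f \<in> L" "g \<in> L" for f g
    by (rule cinner_eq_if_norm_eq[OF sL addL scaleL isoL that])
  then have "unitary_op L (\<Psi> ` F) \<Psi>"
    unfolding unitary_op_def bounded_op_def using addL scaleL image b LF by blast
  then have "fock_model k n E' \<Psi> (\<Psi> ` F)"
    using sE' int LF unfolding L_eq by unfold_locales auto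
  then show ?thesis unfolding F_def by blast
qed

lemma beurling_type_model:
  fixes M :: "(multiword, 'h::chilbert_space) l2 set"
  assumes "beurling_type TYPE('e::chilbert_space) k n M" "finite_rank k n M creation"
  shows "\<exists>(W :: 'e set) V. finite W \<and> orthonormal W \<and> fock_model k n (cspan W) V M"
proof -
  obtain E :: "'e set" and \<Psi> where "closed_csubspace E" "inner_multi_analytic k n E UNIV \<Psi>" "M = \<Psi> ` fock k n E"
    using assms(1) unfolding beurling_type_def by blast
  then obtain E' :: "'e set" where m: "fock_model k n E' \<Psi> M"
    using inner_multi_analytic_model by blast
  then show ?thesis
    using fock_model.finite_rank_spanning_set[OF m assms(2)] by blast
qed

theorem theorem2p9:
  fixes k :: nat and n :: "nat \<Rightarrow> nat"
    and M N :: "(multiword, 'h::chilbert_space) l2 set"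
  assumes "1 \<le> k" and "\<forall>i\<in>{1..k}. 1 \<le> n i"
    and "beurling_type TYPE('e1::chilbert_space) k n M"
    and "beurling_type TYPE('e2::chilbert_space) k n N"
    and "finite_rank k n M creation"
    and "finite_rank k n N creation"
    and "\<forall>V. reducing_subspace k n V \<and> V \<subseteq> M \<longrightarrow> V = {0}"
    and "\<forall>V. reducing_subspace k n V \<and> V \<subseteq> N \<longrightarrow> V = {0}"
  shows "unitarily_equivalent k n M N \<longleftrightarrow> curv k n M creation = curv k n N creation"
proof -
  obtain W :: "'e1 set" and V where W: "finite W" "orthonormal W" and V: "fock_model k n (cspan W) V M"
    using beurling_type_model[OF assms(3,5)] by blast
  obtain W' :: "'e2 set" and V' where W': "finite W'" "orthonormal W'" and V': "fock_model k n (cspan W') V' N"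
    using beurling_type_model[OF assms(4,6)] by blast
  have curv: "curv k n M creation = card W" "curv k n N creation = card W'"
    using fock_model.curv_eq[OF V assms(2) W] fock_model.curv_eq[OF V' assms(2) W'] by simp_all
  show ?thesis
  proof
    assume "unitarily_equivalent k n M N"
    then obtain U where "unitary_op M N U"
      "\<forall>i\<in>{1..k}. \<forall>j\<in>{1..n i}. \<forall>f\<in>M. U (creation i j f) = creation i j (U f)"
      unfolding unitarily_equivalent_def by blast
    \<comment> \<open>A model of \<open>N\<close> over the basis of \<open>M\<close>, so
      \<open>curv_eq\<close> evaluates the curvature of \<open>N\<close> a second time.\<close>
    then have "fock_model k n (cspan W) (\<lambda>f. U (V f)) N"
      by (intro fock_model.compose[OF V]) auto
    then have "curv k n N creation = card W"
      by (rule fock_model.curv_eq[OF _ assms(2) W refl])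
    then show "curv k n M creation = curv k n N creation" using curv(1) by simp
  next
    assume "curv k n M creation = curv k n N creation"
    then have "card W = card W'" using curv by simp
    then obtain V0 where V0: "fock_model k n (cspan W) V0 (fock k n (cspan W'))"
      using fock_model_equal_card[OF W W'] by blast
    \<comment> \<open>Exchange the coefficient space in the model of \<open>N\<close>, so that both
      models share \<open>cspan W\<close> as \<open>unitarily_equivalent_if_models\<close>
      demands.\<close>
    have "fock_model k n (cspan W) (\<lambda>f. V' (V0 f)) N"
      by (rule fock_model.compose[OF V0 fock_model.unitary_V[OF V'] fock_model.intertwines[OF V']])
    then show "unitarily_equivalent k n M N" by (rule unitarily_equivalent_if_models[OF V])
  qed
qed

end
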